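(* Let $T$ be a complete first-order theory whose dp-rank is additive and finite. If $a,b$ are finite tuples, $A$ is a set, and $\mathrm{tp}(a/Ab)$ does not fork over $A$, then $\mathrm{dpr}(a/A)=\mathrm{dpr}(a/Ab)$.
   Context: $T$ is a complete first-order theory with monster model $\mathfrak{C}$; all sets and tuples are taken in $\mathfrak{C}$. dp-rank: for a partial type $\Sigma(x)$ over $A$ and a cardinal $\kappa$, $\mathrm{dpr}(\Sigma)<\kappa$ if for every family $(I_\alpha)_{\alpha<\kappa}$ of $A$-mutually indiscernible infinite sequences and every $b\models\Sigma$ there is $\beta<\kappa$ such that $I_\beta$ is indiscernible over $bA$; otherwise $\mathrm{dpr}(\Sigma)\ge\kappa$. The dp-rank (of $T$) is finite if $\mathrm{dpr}(x=x)<n$ for some $n<\omega$ ($x$ a single variable). In this case $\mathrm{tp}(a/A)$ has finite dp-rank for every finite tuple $a$ and set $A$ (by sub-additivity of dp-rank), and $\mathrm{dpr}(a/A)$ denotes the largest $n<\omega$ such that $\mathrm{dpr}(\mathrm{tp}(a/A))\ge n$. The dp-rank is additive if for any two finite tuples $a,b$ and any set $A$, $\mathrm{dpr}(ab/A)=\mathrm{dpr}(a/Ab)+\mathrm{dpr}(b/A)$. *)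

theory Defs
  imports Main "HOL-Library.Extended_Nat"
begin

unbundle cardinal_syntax

section \<open>First-order logic\<close>

datatype 'f tm = Var nat | App 'f "'f tm list"

datatype ('f, 'r) fm =
    Eq "'f tm" "'f tm"
  | Rel 'r "'f tm list"
  | Neg "('f, 'r) fm"
  | And "('f, 'r) fm" "('f, 'r) fm"
  | Ex nat "('f, 'r) fm"

text \<open>Symbols come with their arities; constants are function symbols of arity 0.\<close>

record ('f, 'r) language =
  funs :: "('f \<times> nat) set"
  rels :: "('r \<times> nat) set"

fun wf_tm :: "('f, 'r) language \<Rightarrow> 'f tm \<Rightarrow> bool" where
  "wf_tm L (Var i) \<longleftrightarrow> True"
| "wf_tm L (App f ts) \<longleftrightarrow> (f, length ts) \<in> funs L \<and> (\<forall>t\<in>set ts. wf_tm L t)"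

fun wf_fm :: "('f, 'r) language \<Rightarrow> ('f, 'r) fm \<Rightarrow> bool" where
  "wf_fm L (Eq s t) \<longleftrightarrow> wf_tm L s \<and> wf_tm L t"
| "wf_fm L (Rel r ts) \<longleftrightarrow> (r, length ts) \<in> rels L \<and> (\<forall>t\<in>set ts. wf_tm L t)"
| "wf_fm L (Neg \<phi>) \<longleftrightarrow> wf_fm L \<phi>"
| "wf_fm L (And \<phi> \<psi>) \<longleftrightarrow> wf_fm L \<phi> \<and> wf_fm L \<psi>"
| "wf_fm L (Ex i \<phi>) \<longleftrightarrow> wf_fm L \<phi>"

fun vars_tm :: "'f tm \<Rightarrow> nat set" where
  "vars_tm (Var i) = {i}"
| "vars_tm (App f ts) = (\<Union>t\<in>set ts. vars_tm t)"

fun fv :: "('f, 'r) fm \<Rightarrow> nat set" where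
  "fv (Eq s t) = vars_tm s \<union> vars_tm t"
| "fv (Rel r ts) = (\<Union>t\<in>set ts. vars_tm t)"
| "fv (Neg \<phi>) = fv \<phi>"
| "fv (And \<phi> \<psi>) = fv \<phi> \<union> fv \<psi>"
| "fv (Ex i \<phi>) = fv \<phi> - {i}"

record ('f, 'r, 'a) struct =
  univ :: "'a set"
  fun_of :: "'f \<Rightarrow> 'a list \<Rightarrow> 'a"
  rel_of :: "'r \<Rightarrow> 'a list \<Rightarrow> bool"

definition is_structure :: "('f, 'r) language \<Rightarrow> ('f, 'r, 'a) struct \<Rightarrow> bool" where
  "is_structure L M \<longleftrightarrow> univ M \<noteq> {} \<and>
     (\<forall>(f, n)\<in>funs L. \<forall>as. length as = n \<and> set as \<subseteq> univ M \<longrightarrow> fun_of M f as \<in> univ M)"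

fun val :: "('f, 'r, 'a) struct \<Rightarrow> (nat \<Rightarrow> 'a) \<Rightarrow> 'f tm \<Rightarrow> 'a" where
  "val M e (Var i) = e i"
| "val M e (App f ts) = fun_of M f (map (val M e) ts)"

fun sat :: "('f, 'r, 'a) struct \<Rightarrow> (nat \<Rightarrow> 'a) \<Rightarrow> ('f, 'r) fm \<Rightarrow> bool" where
  "sat M e (Eq s t) \<longleftrightarrow> val M e s = val M e t"
| "sat M e (Rel r ts) \<longleftrightarrow> rel_of M r (map (val M e) ts)"
| "sat M e (Neg \<phi>) \<longleftrightarrow> \<not> sat M e \<phi>"
| "sat M e (And \<phi> \<psi>) \<longleftrightarrow> sat M e \<phi> \<and> sat M e \<psi>"
| "sat M e (Ex i \<phi>) \<longleftrightarrow> (\<exists>x\<in>univ M. sat M (e(i := x)) \<phi>)"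

definition sentences :: "('f, 'r) language \<Rightarrow> ('f, 'r) fm set" where
  "sentences L = {\<phi>. wf_fm L \<phi> \<and> fv \<phi> = {}}"

text \<open>A complete theory is taken to be deductively closed, so it contains exactly one of
  \<open>\<phi>\<close> and \<open>\<not> \<phi>\<close> for every sentence \<open>\<phi>\<close>. Consistency is not part of this predicate:
  wherever it is used, a model of the theory is given.\<close>

definition complete_theory :: "('f, 'r) language \<Rightarrow> ('f, 'r) fm set \<Rightarrow> bool" where
  "complete_theory L T \<longleftrightarrow> T \<subseteq> sentences L \<and>
     (\<forall>\<phi>\<in>sentences L. (\<phi> \<in> T) \<noteq> (Neg \<phi> \<in> T))"

definition is_model :: "('f, 'r) language \<Rightarrow> ('f, 'r) fm set \<Rightarrow> ('f, 'r, 'a) struct \<Rightarrow> bool" where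
  "is_model L T M \<longleftrightarrow> is_structure L M \<and> (\<forall>\<phi>\<in>T. \<forall>e. range e \<subseteq> univ M \<longrightarrow> sat M e \<phi>)"


section \<open>Types over parameter sets\<close>

text \<open>Finite tuples are lists. A formula \<open>\<phi>(x, c)\<close> in an \<open>m\<close>-tuple of variables \<open>x\<close> and with
  parameters \<open>c\<close> is the pair \<open>(\<phi>, c)\<close>: the variables with indices \<open>0, \<dots>, m - 1\<close> stand
  for \<open>x\<close>, and the next \<open>length c\<close> ones for the parameters.\<close>

type_synonym ('f, 'r, 'a) pfm = "('f, 'r) fm \<times> 'a list"

definition formulas :: "('f, 'r) language \<Rightarrow> 'a set \<Rightarrow> nat \<Rightarrow> ('f, 'r, 'a) pfm set" where
  "formulas L A m = {(\<phi>, c). wf_fm L \<phi> \<and> set c \<subseteq> A \<and> fv \<phi> \<subseteq> {..<m + length c}}"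

definition holds :: "('f, 'r, 'a) struct \<Rightarrow> ('f, 'r, 'a) pfm \<Rightarrow> 'a list \<Rightarrow> bool" where
  "holds M p a = (case p of (\<phi>, c) \<Rightarrow> sat M (\<lambda>i. (a @ c) ! i) \<phi>)"

definition tuples :: "('f, 'r, 'a) struct \<Rightarrow> nat \<Rightarrow> 'a list set" where
  "tuples M m = {a. length a = m \<and> set a \<subseteq> univ M}"

definition realizations ::
    "('f, 'r, 'a) struct \<Rightarrow> nat \<Rightarrow> ('f, 'r, 'a) pfm set \<Rightarrow> 'a list set" where
  "realizations M m \<Sigma> = {a \<in> tuples M m. \<forall>p\<in>\<Sigma>. holds M p a}"

definition tp :: "('f, 'r) language \<Rightarrow> ('f, 'r, 'a) struct \<Rightarrow> 'a list \<Rightarrow> 'a set \<Rightarrow>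
    ('f, 'r, 'a) pfm set" where
  "tp L M a A = {p \<in> formulas L A (length a). holds M p a}"


section \<open>Monster models\<close>

definition elementary_on :: "('f, 'r) language \<Rightarrow> ('f, 'r, 'a) struct \<Rightarrow> 'a set \<Rightarrow>
    ('a \<Rightarrow> 'a) \<Rightarrow> bool" where
  "elementary_on L M A g \<longleftrightarrow> g ` A \<subseteq> univ M \<and>
     (\<forall>a. set a \<subseteq> A \<longrightarrow> tp L M (map g a) {} = tp L M a {})"

definition automorphism :: "('f, 'r) language \<Rightarrow> ('f, 'r, 'a) struct \<Rightarrow> ('a \<Rightarrow> 'a) \<Rightarrow> bool" where
  "automorphism L M g \<longleftrightarrow> bij_betw g (univ M) (univ M) \<and>
     (\<forall>(f, n)\<in>funs L. \<forall>a\<in>tuples M n. g (fun_of M f a) = fun_of M f (map g a)) \<and>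
     (\<forall>(r, n)\<in>rels L. \<forall>a\<in>tuples M n. rel_of M r (map g a) \<longleftrightarrow> rel_of M r a)"

definition small :: "'k rel \<Rightarrow> ('f, 'r, 'a) struct \<Rightarrow> 'a set \<Rightarrow> bool" where
  "small \<kappa> M A \<longleftrightarrow> A \<subseteq> univ M \<and> |A| <o \<kappa>"

definition saturated :: "('f, 'r) language \<Rightarrow> 'k rel \<Rightarrow> ('f, 'r, 'a) struct \<Rightarrow> bool" where
  "saturated L \<kappa> M \<longleftrightarrow> (\<forall>A m. \<forall>\<Sigma> \<subseteq> formulas L A m. small \<kappa> M A \<longrightarrow>
     (\<forall>\<Sigma>\<^sub>0 \<subseteq> \<Sigma>. finite \<Sigma>\<^sub>0 \<longrightarrow> realizations M m \<Sigma>\<^sub>0 \<noteq> {}) \<longrightarrow> realizations M m \<Sigma> \<noteq> {})"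

definition strongly_homogeneous ::
    "('f, 'r) language \<Rightarrow> 'k rel \<Rightarrow> ('f, 'r, 'a) struct \<Rightarrow> bool" where
  "strongly_homogeneous L \<kappa> M \<longleftrightarrow> (\<forall>A g. small \<kappa> M A \<longrightarrow> elementary_on L M A g \<longrightarrow>
     (\<exists>h. automorphism L M h \<and> (\<forall>x\<in>A. h x = g x)))"

text \<open>The set of \<open>L\<close>-formulas is always infinite, so the bound below says
  \<open>\<kappa> > |L| + \<aleph>\<^sub>0\<close>.\<close>

definition monster_model :: "('f, 'r) language \<Rightarrow> ('f, 'r) fm set \<Rightarrow> 'k rel \<Rightarrow>
    ('f, 'r, 'a) struct \<Rightarrow> bool" where
  "monster_model L T \<kappa> M \<longleftrightarrow> is_model L T M \<and> Card_order \<kappa> \<and> |{\<phi>. wf_fm L \<phi>}| <o \<kappa> \<and>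
     saturated L \<kappa> M \<and> strongly_homogeneous L \<kappa> M"


section \<open>Indiscernible sequences and dp-rank\<close>

text \<open>Infinite sequences are indexed by \<open>\<omega>\<close>; their members are finite tuples of a common length.\<close>

definition sequence :: "('f, 'r, 'a) struct \<Rightarrow> (nat \<Rightarrow> 'a list) \<Rightarrow> bool" where
  "sequence M I \<longleftrightarrow> (\<exists>l. \<forall>i. I i \<in> tuples M l)"

definition seq_elems :: "(nat \<Rightarrow> 'a list) \<Rightarrow> 'a set" where
  "seq_elems I = (\<Union>i. set (I i))"

definition indiscernible :: "('f, 'r) language \<Rightarrow> ('f, 'r, 'a) struct \<Rightarrow> 'a set \<Rightarrow>
    (nat \<Rightarrow> 'a list) \<Rightarrow> bool" where
  "indiscernible L M A I \<longleftrightarrow> sequence M I \<and>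
     (\<forall>is js. sorted_wrt (<) is \<and> sorted_wrt (<) js \<and> length is = length js \<longrightarrow>
        tp L M (concat (map I is)) A = tp L M (concat (map I js)) A)"

definition mutually_indiscernible :: "('f, 'r) language \<Rightarrow> ('f, 'r, 'a) struct \<Rightarrow> 'a set \<Rightarrow>
    'i set \<Rightarrow> ('i \<Rightarrow> nat \<Rightarrow> 'a list) \<Rightarrow> bool" where
  "mutually_indiscernible L M A J I \<longleftrightarrow>
     (\<forall>\<alpha>\<in>J. indiscernible L M (A \<union> (\<Union>\<beta>\<in>J - {\<alpha>}. seq_elems (I \<beta>))) (I \<alpha>))"

text \<open>\<open>dpr(\<Sigma>) < \<kappa>\<close> for a partial type \<open>\<Sigma>\<close> over \<open>A\<close> in \<open>m\<close> variables, where the cardinal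
  \<open>\<kappa>\<close> is given by an index set \<open>J\<close> of that cardinality.\<close>

definition dpr_less :: "('f, 'r) language \<Rightarrow> ('f, 'r, 'a) struct \<Rightarrow> 'a set \<Rightarrow> nat \<Rightarrow>
    ('f, 'r, 'a) pfm set \<Rightarrow> 'i set \<Rightarrow> bool" where
  "dpr_less L M A m \<Sigma> J \<longleftrightarrow>
     (\<forall>I. mutually_indiscernible L M A J I \<longrightarrow>
       (\<forall>b\<in>realizations M m \<Sigma>. \<exists>\<beta>\<in>J. indiscernible L M (A \<union> set b) (I \<beta>)))"

text \<open>The largest \<open>n < \<omega>\<close> with \<open>dpr(tp(a/A)) \<ge> n\<close>; it is \<open>\<infinity>\<close> if there is no largest one.\<close>

definition dpr :: "('f, 'r) language \<Rightarrow> ('f, 'r, 'a) struct \<Rightarrow> 'a list \<Rightarrow> 'a set \<Rightarrow> enat" where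
  "dpr L M a A = Sup {enat n | n. \<not> dpr_less L M A (length a) (tp L M a A) {..<n}}"

definition dp_rank_finite :: "('f, 'r) language \<Rightarrow> ('f, 'r, 'a) struct \<Rightarrow> bool" where
  "dp_rank_finite L M \<longleftrightarrow> (\<exists>n::nat. dpr_less L M {} 1 {(Eq (Var 0) (Var 0), [])} {..<n})"

definition dp_rank_additive :: "('f, 'r) language \<Rightarrow> 'k rel \<Rightarrow> ('f, 'r, 'a) struct \<Rightarrow> bool" where
  "dp_rank_additive L \<kappa> M \<longleftrightarrow>
     (\<forall>a b A. set a \<subseteq> univ M \<and> set b \<subseteq> univ M \<and> small \<kappa> M A \<longrightarrow>
        dpr L M (a @ b) A = dpr L M a (A \<union> set b) + dpr L M b A)"


section \<open>Forking\<close>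

text \<open>The formula \<open>\<phi>(x, c)\<close> divides over \<open>A\<close> if for some \<open>k\<close> there are realizations
  \<open>c\<^sub>0, c\<^sub>1, \<dots>\<close> of \<open>tp(c/A)\<close> such that \<open>{\<phi>(x, c\<^sub>i) | i < \<omega>}\<close> is \<open>k\<close>-inconsistent.\<close>

definition divides :: "('f, 'r) language \<Rightarrow> ('f, 'r, 'a) struct \<Rightarrow> 'a set \<Rightarrow> nat \<Rightarrow>
    ('f, 'r, 'a) pfm \<Rightarrow> bool" where
  "divides L M A m p \<longleftrightarrow> (case p of (\<phi>, c) \<Rightarrow>
     \<exists>(k::nat) d. (\<forall>i::nat. d i \<in> realizations M (length c) (tp L M c A)) \<and>
       (\<forall>S. finite S \<and> card S = k \<longrightarrow> realizations M m {(\<phi>, d i) | i. i \<in> S} = {}))"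

definition forks :: "('f, 'r) language \<Rightarrow> ('f, 'r, 'a) struct \<Rightarrow> 'a set \<Rightarrow> nat \<Rightarrow>
    ('f, 'r, 'a) pfm set \<Rightarrow> bool" where
  "forks L M A m \<Sigma> \<longleftrightarrow> (\<exists>D. finite D \<and> D \<subseteq> formulas L (univ M) m \<and>
     (\<forall>p\<in>D. divides L M A m p) \<and>
     (\<forall>a\<in>realizations M m \<Sigma>. \<exists>p\<in>D. holds M p a))"

end

theory Submission
  imports Defs "HOL-Library.Countable_Set" "HOL-Library.Product_Lexorder"
begin

text \<open>Say that a tuple breaks a sequence if the sequence is not indiscernible over \<open>A\<close> and the tuple.
  Write \<open>r = dpr(a/A)\<close>, \<open>N = dpr(b/A)\<close> and \<open>d = dpr(b/Aa)\<close>; all these ranks are finite. Enlarging the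
  parameter set does not raise dp-rank (\<open>dpr_less_mono\<close>), so if the theorem fails, then
  \<open>dpr(a/Ab) < r\<close>. Computing \<open>dpr(ab/A)\<close> by additivity in both orders gives \<open>d < N\<close>.

  Let \<open>I\<^sub>0, \<dots>\<close> be \<open>N\<close> mutually \<open>A\<close>-indiscernible sequences that are all broken by a realization of
  \<open>tp(b/A)\<close>. By compactness they can be stretched to sequences of order type \<open>\<omega> * \<omega>\<close>, and cut into
  infinitely many blocks of \<open>N\<close> sequences each. All sequences in all blocks are mutually
  indiscernible, and each block satisfies the same formulas as the original sequences, so for each
  \<open>i\<close> there is a conjugate \<open>b\<^sub>i\<close> of \<open>b\<close> over \<open>A\<close> that breaks the \<open>i\<close>-th block (\<open>independent_copies\<close>).

  Since no formula of \<open>tp(a/Ab)\<close> divides over \<open>A\<close>, each of them is consistent along \<open>k\<close> of these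
  conjugates, where \<open>k = r + 1\<close> (\<open>non_forking_consistent\<close>). Indiscernibility of the blocks and
  compactness turn this into one tuple \<open>a'\<close> and tuples \<open>b'\<^sub>i\<close>, \<open>i < k\<close>, such that \<open>a' b'\<^sub>i\<close> realizes
  \<open>tp(ab/A)\<close> and \<open>b'\<^sub>i\<close> breaks the \<open>i\<close>-th block (\<open>simultaneous_realization\<close>). The concatenation \<open>c\<close> of
  the \<open>b'\<^sub>i\<close> breaks \<open>k N\<close> mutually indiscernible sequences (\<open>dpr_concat_ge\<close>). By additivity
  (\<open>dpr_concat_le\<close>),
  \<open>k N \<le> dpr(c/A) \<le> dpr(ca'/A) = dpr(c/Aa') + dpr(a'/A) \<le> k d + r < k (d + 1) \<le> k N\<close>,
  a contradiction.

  The blocks take the place of an indiscernible sequence of conjugates: the \<open>b\<^sub>i\<close> are chosen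
  independently of each other, and only the indiscernibility of their blocks is used.

  Formulas are handled through the predicates that they define on
  assignments (\<open>definable\<close>), and indiscernibility as invariance of such predicates under changes of
  positions that preserve their order (\<open>mutually_indiscernible_iff\<close>).\<close>


section \<open>Definable predicates of assignments\<close>

lemma val_cong: "(\<And>i. i \<in> vars_tm t \<Longrightarrow> e i = e' i) \<Longrightarrow> val M e t = val M e' t"
proof (induction t)
  case (App f ts)
  have "map (val M e) ts = map (val M e') ts"
    using App by auto
  then show ?case by (simp only: val.simps)
qed auto

lemma sat_cong: "(\<And>i. i \<in> fv \<phi> \<Longrightarrow> e i = e' i) \<Longrightarrow> sat M e \<phi> = sat M e' \<phi>"
proof (induction \<phi> arbitrary: e e')
  case (Eq s t)
  then show ?case using val_cong[of s e e' M] val_cong[of t e e' M] by auto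
next
  case (Rel r ts)
  have "map (val M e) ts = map (val M e') ts"
    using Rel by (auto intro!: val_cong)
  then show ?case by (simp only: sat.simps)
next
  case (Neg \<phi>)
  then show ?case by (metis fv.simps(3) sat.simps(3))
next
  case (And \<phi>1 \<phi>2)
  then show ?case by (metis UnCI fv.simps(4) sat.simps(4))
next
  case (Ex k \<phi>)
  have "sat M (e(k := x)) \<phi> = sat M (e'(k := x)) \<phi>" for x
    using Ex.prems by (intro Ex.IH) auto
  then show ?case by simp
qed

lemma finite_vars_tm: "finite (vars_tm t)"
  by (induction t) auto

lemma finite_fv: "finite (fv \<phi>)"
  by (induction \<phi>) (auto simp: finite_vars_tm)

fun rename_tm :: "(nat \<Rightarrow> nat) \<Rightarrow> 'f tm \<Rightarrow> 'f tm" where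
  "rename_tm f (Var i) = Var (f i)"
| "rename_tm f (App g ts) = App g (map (rename_tm f) ts)"

lemma rename_tm:
  "wf_tm L (rename_tm f t) = wf_tm L t"
  "vars_tm (rename_tm f t) = f ` vars_tm t"
  "val M e (rename_tm f t) = val M (\<lambda>i. e (f i)) t"
proof (induction t)
  case (App g ts)
  { case 1 show ?case using App by simp }
  { case 2 show ?case using App by auto }
  { case 3
    have "map (val M e \<circ> rename_tm f) ts = map (val M (\<lambda>i. e (f i))) ts" using App(3) by auto
    then show ?case by (simp only: rename_tm.simps val.simps map_map) }
qed auto

lemma rename_fm:
  assumes "wf_fm L \<phi>"
  shows "\<exists>\<phi>'. wf_fm L \<phi>' \<and> fv \<phi>' \<subseteq> f ` fv \<phi> \<and> (\<forall>e. sat M e \<phi>' = sat M (\<lambda>i. e (f i)) \<phi>)"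
  using assms
proof (induction \<phi> arbitrary: f)
  case (Eq s t)
  then show ?case
    by (intro exI[of _ "Eq (rename_tm f s) (rename_tm f t)"]) (auto simp: rename_tm)
next
  case (Rel r ts)
  have "map (val M e \<circ> rename_tm f) ts = map (val M (\<lambda>i. e (f i))) ts" for e
    by (auto simp: rename_tm)
  then have "sat M e (Rel r (map (rename_tm f) ts)) = sat M (\<lambda>i. e (f i)) (Rel r ts)" for e
    by (simp only: sat.simps map_map)
  then show ?case
    using Rel by (intro exI[of _ "Rel r (map (rename_tm f) ts)"]) (auto simp: rename_tm)
next
  case (Neg \<phi>)
  then obtain \<phi>' where "wf_fm L \<phi>'" "fv \<phi>' \<subseteq> f ` fv \<phi>" "\<forall>e. sat M e \<phi>' = sat M (\<lambda>i. e (f i)) \<phi>"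
    by (metis wf_fm.simps(3))
  then show ?case by (intro exI[of _ "Neg \<phi>'"]) auto
next
  case (And \<phi>1 \<phi>2)
  obtain \<phi>1' where "wf_fm L \<phi>1'" "fv \<phi>1' \<subseteq> f ` fv \<phi>1" "\<forall>e. sat M e \<phi>1' = sat M (\<lambda>i. e (f i)) \<phi>1"
    using And.IH(1)[of f] And.prems by auto
  moreover obtain \<phi>2' where "wf_fm L \<phi>2'" "fv \<phi>2' \<subseteq> f ` fv \<phi>2" "\<forall>e. sat M e \<phi>2' = sat M (\<lambda>i. e (f i)) \<phi>2"
    using And.IH(2)[of f] And.prems by auto
  ultimately show ?case by (intro exI[of _ "And \<phi>1' \<phi>2'"]) auto
next
  case (Ex i \<phi>)
  \<comment> \<open>The bound variable moves to a fresh \<open>k\<close> so that no renamed variable is captured.\<close>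
  obtain k where k: "k \<notin> f ` fv \<phi>"
    using ex_new_if_finite[OF infinite_UNIV_nat] finite_fv finite_imageI by metis
  obtain \<phi>' where \<phi>': "wf_fm L \<phi>'" "fv \<phi>' \<subseteq> (f(i := k)) ` fv \<phi>"
      "\<forall>e. sat M e \<phi>' = sat M (\<lambda>j. e ((f(i := k)) j)) \<phi>"
    using Ex.IH[of "f(i := k)"] Ex.prems by auto
  have "sat M (\<lambda>j. (e(k := x)) ((f(i := k)) j)) \<phi> = sat M ((\<lambda>i. e (f i))(i := x)) \<phi>" for e x
    using k by (intro sat_cong) auto
  then have "sat M e (Ex k \<phi>') = sat M (\<lambda>i. e (f i)) (Ex i \<phi>)" for e
    by (simp only: sat.simps \<phi>'(3))
  moreover have "fv (Ex k \<phi>') \<subseteq> f ` fv (Ex i \<phi>)"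
    using \<phi>'(2) by (auto split: if_splits)
  ultimately show ?case using \<phi>'(1) by (intro exI[of _ "Ex k \<phi>'"]) auto
qed

definition value_in :: "('v \<Rightarrow> 'a) \<Rightarrow> 'v + 'a \<Rightarrow> 'a" where
  "value_in e = case_sum e id"

lemma value_in_simps [simp]: "value_in e (Inl v) = e v" "value_in e (Inr c) = c"
  by (auto simp: value_in_def)

text \<open>Renaming and substituting variables in formulas is bypassed by arguing about predicates of
  assignments \<open>'v \<Rightarrow> 'a\<close>, for an arbitrary type \<open>'v\<close> of variables: a formula \<open>\<phi>\<close> together with a
  map \<open>\<sigma>\<close> that sends each of its variables either to a variable in \<open>V\<close> or to a parameter in
  \<open>A\<close>.\<close>

definition definable :: "('f, 'r) language \<Rightarrow> ('f, 'r, 'a) struct \<Rightarrow> 'v set \<Rightarrow> 'a set \<Rightarrow>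
    (('v \<Rightarrow> 'a) \<Rightarrow> bool) \<Rightarrow> bool" where
  "definable L M V A P \<longleftrightarrow> (\<exists>\<phi> \<sigma>. wf_fm L \<phi> \<and> \<sigma> ` fv \<phi> \<subseteq> V <+> A \<and>
     P = (\<lambda>e. sat M (\<lambda>i. value_in e (\<sigma> i)) \<phi>))"

lemma definableI:
  assumes "wf_fm L \<phi>" "\<sigma> ` fv \<phi> \<subseteq> V <+> A" "\<And>e. P e = sat M (\<lambda>i. value_in e (\<sigma> i)) \<phi>"
  shows "definable L M V A P"
  using assms unfolding definable_def by blast

lemma definable_cong:
  assumes "definable L M V A P" "\<And>v. v \<in> V \<Longrightarrow> e v = e' v"
  shows "P e = P e'"
proof -
  obtain \<phi> \<sigma> where "\<sigma> ` fv \<phi> \<subseteq> V <+> A" "P = (\<lambda>e. sat M (\<lambda>i. value_in e (\<sigma> i)) \<phi>)"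
    using assms(1) unfolding definable_def by blast
  then show ?thesis
    using assms(2) by (fastforce intro!: sat_cong split: sum.splits)
qed

lemma definable_finite_support:
  assumes "definable L M V A P"
  obtains V0 where "finite V0" "V0 \<subseteq> V" "definable L M V0 A P"
proof -
  obtain \<phi> \<sigma> where *: "wf_fm L \<phi>" "\<sigma> ` fv \<phi> \<subseteq> V <+> A"
      "P = (\<lambda>e. sat M (\<lambda>i. value_in e (\<sigma> i)) \<phi>)"
    using assms unfolding definable_def by blast
  define V0 where "V0 = Inl -` (\<sigma> ` fv \<phi>)"
  have "finite V0"
    unfolding V0_def by (intro finite_vimageI finite_imageI finite_fv) simp
  moreover have "V0 \<subseteq> V" using *(2) unfolding V0_def by auto
  moreover have "\<sigma> i \<in> V0 <+> A" if "i \<in> fv \<phi>" for i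
    using that *(2) unfolding V0_def by (cases "\<sigma> i") (force simp: image_subset_iff)+
  then have "\<sigma> ` fv \<phi> \<subseteq> V0 <+> A" by blast
  then have "definable L M V0 A P" unfolding definable_def using * by blast
  ultimately show thesis by (rule that)
qed

lemma definable_subst:
  assumes "definable L M V A P" "\<And>v. v \<in> V \<Longrightarrow> s v \<in> W <+> B" "A \<subseteq> B"
  shows "definable L M W B (\<lambda>e. P (\<lambda>v. value_in e (s v)))"
proof -
  obtain \<phi> \<sigma> where *: "wf_fm L \<phi>" "\<sigma> ` fv \<phi> \<subseteq> V <+> A"
      "P = (\<lambda>e. sat M (\<lambda>i. value_in e (\<sigma> i)) \<phi>)"
    using assms(1) unfolding definable_def by blast
  have "(case_sum s Inr \<circ> \<sigma>) ` fv \<phi> \<subseteq> W <+> B"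
    using *(2) assms(2,3) by (fastforce split: sum.splits)
  moreover have "value_in (\<lambda>v. value_in e (s v)) (\<sigma> i) = value_in e ((case_sum s Inr \<circ> \<sigma>) i)" for e i
    by (auto split: sum.splits)
  ultimately show ?thesis
    by (intro definableI[OF *(1), of "case_sum s Inr \<circ> \<sigma>"]) (auto simp: *(3))
qed

lemma definable_mono:
  assumes "definable L M V A P" "V \<subseteq> W" "A \<subseteq> B"
  shows "definable L M W B P"
  using definable_subst[of L M V A P Inl W B] assms by (auto simp: comp_def)

lemma definable_reindex:
  assumes "definable L M V A P" "\<And>v. v \<in> V \<Longrightarrow> f v \<in> W"
  shows "definable L M W A (\<lambda>e. P (\<lambda>v. e (f v)))"
  using definable_subst[of L M V A P "Inl \<circ> f" W A] assms by (auto simp: comp_def)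

lemma definable_Neg:
  assumes "definable L M V A P"
  shows "definable L M V A (\<lambda>e. \<not> P e)"
proof -
  obtain \<phi> \<sigma> where *: "wf_fm L \<phi>" "\<sigma> ` fv \<phi> \<subseteq> V <+> A"
      "P = (\<lambda>e. sat M (\<lambda>i. value_in e (\<sigma> i)) \<phi>)"
    using assms unfolding definable_def by blast
  then show ?thesis by (intro definableI[of L "Neg \<phi>" \<sigma>]) auto
qed

lemma definable_And:
  assumes "definable L M V A P" "definable L M V A Q"
  shows "definable L M V A (\<lambda>e. P e \<and> Q e)"
proof -
  obtain \<phi> \<sigma> where 1: "wf_fm L \<phi>" "\<sigma> ` fv \<phi> \<subseteq> V <+> A"
      "P = (\<lambda>e. sat M (\<lambda>i. value_in e (\<sigma> i)) \<phi>)"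
    using assms(1) unfolding definable_def by blast
  obtain \<psi> \<tau> where 2: "wf_fm L \<psi>" "\<tau> ` fv \<psi> \<subseteq> V <+> A"
      "Q = (\<lambda>e. sat M (\<lambda>i. value_in e (\<tau> i)) \<psi>)"
    using assms(2) unfolding definable_def by blast
  \<comment> \<open>The variables of the two formulas are separated into the even and the odd numbers.\<close>
  obtain \<phi>' where \<phi>': "wf_fm L \<phi>'" "fv \<phi>' \<subseteq> (\<lambda>i. 2 * i) ` fv \<phi>"
      "\<And>e. sat M e \<phi>' = sat M (\<lambda>i. e (2 * i)) \<phi>"
    using rename_fm[OF 1(1), of "\<lambda>i. 2 * i" M] by blast
  obtain \<psi>' where \<psi>': "wf_fm L \<psi>'" "fv \<psi>' \<subseteq> (\<lambda>i. Suc (2 * i)) ` fv \<psi>"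
      "\<And>e. sat M e \<psi>' = sat M (\<lambda>i. e (Suc (2 * i))) \<psi>"
    using rename_fm[OF 2(1), of "\<lambda>i. Suc (2 * i)" M] by blast
  define \<rho> where "\<rho> i = (if even i then \<sigma> (i div 2) else \<tau> (i div 2))" for i
  have \<rho>: "\<rho> (2 * i) = \<sigma> i" "\<rho> (Suc (2 * i)) = \<tau> i" for i
    by (auto simp: \<rho>_def)
  have "\<rho> ` fv (And \<phi>' \<psi>') \<subseteq> V <+> A"
  proof
    fix x assume "x \<in> \<rho> ` fv (And \<phi>' \<psi>')"
    then have "x \<in> \<sigma> ` fv \<phi> \<or> x \<in> \<tau> ` fv \<psi>"
      using \<phi>'(2) \<psi>'(2) by (auto simp: \<rho>)
    then show "x \<in> V <+> A" using 1(2) 2(2) by blast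
  qed
  then show ?thesis
    using \<phi>'(1) \<psi>'(1)
    by (intro definableI[of L "And \<phi>' \<psi>'" \<rho>]) (auto simp: \<phi>'(3) \<psi>'(3) \<rho> 1(3) 2(3))
qed

lemma definable_Xor:
  assumes "definable L M V A P" "definable L M V A Q"
  shows "definable L M V A (\<lambda>e. P e \<noteq> Q e)"
proof -
  have "definable L M V A (\<lambda>e. \<not> (P e \<and> Q e) \<and> \<not> (\<not> P e \<and> \<not> Q e))"
    using assms by (intro definable_And definable_Neg)
  moreover have "(\<lambda>e. \<not> (P e \<and> Q e) \<and> \<not> (\<not> P e \<and> \<not> Q e)) = (\<lambda>e. P e \<noteq> Q e)" by auto
  ultimately show ?thesis by simp
qed

lemma definable_True:
  assumes "univ M \<noteq> {}"
  shows "definable L M V A (\<lambda>_. True)"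
  using assms by (intro definableI[of L "Ex 0 (Eq (Var 0) (Var 0))"]) auto

lemma definable_Ball:
  assumes "univ M \<noteq> {}" "finite X" "\<And>x. x \<in> X \<Longrightarrow> definable L M V A (P x)"
  shows "definable L M V A (\<lambda>e. \<forall>x\<in>X. P x e)"
  using assms(2,3)
proof (induction X)
  case empty
  then show ?case using definable_True[OF assms(1)] by simp
next
  case (insert x X)
  then show ?case
    using definable_And[of L M V A "P x" "\<lambda>e. \<forall>x\<in>X. P x e"] by simp
qed

lemma definable_Ex:
  assumes "definable L M V A P"
  shows "definable L M (V - {v}) A (\<lambda>e. \<exists>x\<in>univ M. P (e(v := x)))"
proof -
  obtain \<phi> \<sigma> where *: "wf_fm L \<phi>" "\<sigma> ` fv \<phi> \<subseteq> V <+> A"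
      "P = (\<lambda>e. sat M (\<lambda>i. value_in e (\<sigma> i)) \<phi>)"
    using assms unfolding definable_def by blast
  \<comment> \<open>All variables of \<open>\<phi>\<close> that \<open>\<sigma>\<close> sends to \<open>v\<close> become the variable \<open>0\<close>, which is then bound.\<close>
  define f where "f i = (if \<sigma> i = Inl v then 0 else Suc i)" for i
  obtain \<phi>' where \<phi>': "wf_fm L \<phi>'" "fv \<phi>' \<subseteq> f ` fv \<phi>" "\<And>e. sat M e \<phi>' = sat M (\<lambda>i. e (f i)) \<phi>"
    using rename_fm[OF *(1), of f M] by blast
  define \<rho> where "\<rho> i = \<sigma> (i - 1)" for i
  have "\<rho> ` fv (Ex 0 \<phi>') \<subseteq> (V - {v}) <+> A"
  proof
    fix x assume "x \<in> \<rho> ` fv (Ex 0 \<phi>')"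
    then have "x \<in> \<sigma> ` fv \<phi>" "x \<noteq> Inl v"
      using \<phi>'(2) by (auto simp: \<rho>_def f_def split: if_splits)
    then show "x \<in> (V - {v}) <+> A" using *(2) by auto
  qed
  moreover have "((\<lambda>i. value_in e (\<rho> i))(0 := x)) (f i) = value_in (e(v := x)) (\<sigma> i)" for e x i
    by (cases "\<sigma> i") (auto simp: f_def \<rho>_def)
  ultimately show ?thesis
    using \<phi>'(1) by (intro definableI[of L "Ex 0 \<phi>'" \<rho>]) (simp_all only: wf_fm.simps sat.simps \<phi>'(3) *(3))
qed

text \<open>A definable predicate has finite support, so quantifying over infinitely many variables at
  once stays definable.\<close>

lemma definable_project:
  fixes U :: "'v set"
  assumes ne: "univ M \<noteq> {}" and P: "definable L M V A P"
  shows "definable L M (V - U) A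
    (\<lambda>e. \<exists>e'. (\<forall>v. v \<notin> U \<longrightarrow> e' v = e v) \<and> e' ` U \<subseteq> univ M \<and> P e')"
proof -
  have fin: "definable L M (V - X) A
      (\<lambda>e. \<exists>e'. (\<forall>v. v \<notin> X \<longrightarrow> e' v = e v) \<and> e' ` X \<subseteq> univ M \<and> P e')"
    if "finite X" "definable L M V A P" for X and V :: "'v set" and P
    using that
  proof (induction X arbitrary: V P)
    case empty
    have "(\<exists>e'. (\<forall>v. e' v = e v) \<and> P e') = P e" for e
      using ext by metis
    then show ?case using empty by simp
  next
    case (insert x X)
    have 1: "(\<exists>y\<in>univ M. \<exists>e'. (\<forall>v. v \<notin> X \<longrightarrow> e' v = (e(x := y)) v) \<and> e' ` X \<subseteq> univ M \<and> P e') =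
        (\<exists>e'. (\<forall>v. v \<notin> insert x X \<longrightarrow> e' v = e v) \<and> e' ` insert x X \<subseteq> univ M \<and> P e')"
        (is "?l = ?r") for e
    proof
      assume ?l
      then obtain y e' where "y \<in> univ M" "\<And>v. v \<notin> X \<Longrightarrow> e' v = (e(x := y)) v"
          "e' ` X \<subseteq> univ M" "P e'"
        by blast
      then show ?r using insert.hyps(2) by (intro exI[of _ e']) auto
    next
      assume ?r
      then obtain e' where "\<And>v. v \<notin> insert x X \<Longrightarrow> e' v = e v" "e' ` insert x X \<subseteq> univ M" "P e'"
        by blast
      then show ?l by (intro bexI[of _ "e' x"] exI[of _ e']) auto
    qed
    have "definable L M (V - X - {x}) A (\<lambda>e. \<exists>y\<in>univ M.
        \<exists>e'. (\<forall>v. v \<notin> X \<longrightarrow> e' v = (e(x := y)) v) \<and> e' ` X \<subseteq> univ M \<and> P e')"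
      using definable_Ex[OF insert.IH[OF insert.prems]] by simp
    moreover have "V - X - {x} = V - insert x X" by auto
    ultimately show ?case unfolding 1 by simp
  qed
  obtain V0 where V0: "finite V0" "V0 \<subseteq> V" "definable L M V0 A P"
    using definable_finite_support[OF P] by blast
  obtain u where u: "u \<in> univ M" using ne by blast
  have "(\<exists>e'. (\<forall>v. v \<notin> U \<longrightarrow> e' v = e v) \<and> e' ` U \<subseteq> univ M \<and> P e') =
      (\<exists>e'. (\<forall>v. v \<notin> U \<inter> V0 \<longrightarrow> e' v = e v) \<and> e' ` (U \<inter> V0) \<subseteq> univ M \<and> P e')" (is "?l = ?r") for e
  proof
    assume ?l
    then obtain e' where e': "\<And>v. v \<notin> U \<Longrightarrow> e' v = e v" "e' ` U \<subseteq> univ M" "P e'" by blast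
    have "P (\<lambda>v. if v \<in> U \<inter> V0 then e' v else e v)"
      using definable_cong[OF V0(3), of e' "\<lambda>v. if v \<in> U \<inter> V0 then e' v else e v"] e' by auto
    then show ?r using e'(2)
      by (intro exI[of _ "\<lambda>v. if v \<in> U \<inter> V0 then e' v else e v"]) auto
  next
    assume ?r
    then obtain e' where e': "\<And>v. v \<notin> U \<inter> V0 \<Longrightarrow> e' v = e v" "e' ` (U \<inter> V0) \<subseteq> univ M" "P e'"
      by blast
    have "P (\<lambda>v. if v \<in> U - V0 then u else e' v)"
      using definable_cong[OF V0(3), of e' "\<lambda>v. if v \<in> U - V0 then u else e' v"] e' by auto
    then show ?l using e'(1,2) u
      by (intro exI[of _ "\<lambda>v. if v \<in> U - V0 then u else e' v"]) auto
  qed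
  moreover have "definable L M (V0 - (U \<inter> V0)) A
      (\<lambda>e. \<exists>e'. (\<forall>v. v \<notin> U \<inter> V0 \<longrightarrow> e' v = e v) \<and> e' ` (U \<inter> V0) \<subseteq> univ M \<and> P e')"
    by (rule fin[OF _ V0(3)]) (use V0(1) in auto)
  ultimately show ?thesis using V0(2) by (auto elim!: definable_mono)
qed

lemma definable_imp_formula:
  assumes "definable L M {..<n} A P"
  obtains \<phi> c where "wf_fm L \<phi>" "set c \<subseteq> A" "fv \<phi> \<subseteq> {..<n + length c}"
    "\<And>u. length u = n \<Longrightarrow> sat M (\<lambda>i. (u @ c) ! i) \<phi> = P (nth u)"
proof -
  obtain \<phi> \<sigma> where *: "wf_fm L \<phi>" "\<sigma> ` fv \<phi> \<subseteq> {..<n} <+> A"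
      "P = (\<lambda>e. sat M (\<lambda>i. value_in e (\<sigma> i)) \<phi>)"
    using assms unfolding definable_def by blast
  define X where "X = Inr -` (\<sigma> ` fv \<phi>)"
  have "finite X"
    unfolding X_def by (intro finite_vimageI finite_imageI finite_fv) simp
  then obtain c where c: "set c = X" using finite_list by blast
  then have "\<exists>p<length c. c ! p = x" if "x \<in> X" for x
    using that unfolding c[symmetric] by (auto simp: in_set_conv_nth)
  then obtain idx where idx: "\<And>x. x \<in> X \<Longrightarrow> idx x < length c" "\<And>x. x \<in> X \<Longrightarrow> c ! idx x = x"
    by metis
  define f where "f i = case_sum id (\<lambda>x. n + idx x) (\<sigma> i)" for i
  obtain \<phi>' where \<phi>': "wf_fm L \<phi>'" "fv \<phi>' \<subseteq> f ` fv \<phi>" "\<And>e. sat M e \<phi>' = sat M (\<lambda>i. e (f i)) \<phi>"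
    using rename_fm[OF *(1), of f M] by blast
  have \<sigma>: "(\<exists>t<n. \<sigma> i = Inl t) \<or> (\<exists>x\<in>X. \<sigma> i = Inr x)" if "i \<in> fv \<phi>" for i
    using that *(2) unfolding X_def by (cases "\<sigma> i") (force simp: image_subset_iff)+
  show thesis
  proof
    show "wf_fm L \<phi>'" by fact
    show "set c \<subseteq> A" unfolding c using *(2) unfolding X_def by auto
    have "f i < n + length c" if "i \<in> fv \<phi>" for i
      using \<sigma>[OF that] idx(1) by (auto simp: f_def)
    then show "fv \<phi>' \<subseteq> {..<n + length c}" using \<phi>'(2) by auto
    fix u :: "'c list" assume u: "length u = n"
    have "(u @ c) ! f i = value_in (nth u) (\<sigma> i)" if "i \<in> fv \<phi>" for i
      using \<sigma>[OF that] idx(2) u by (auto simp: f_def nth_append)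
    then show "sat M (\<lambda>i. (u @ c) ! i) \<phi>' = P (nth u)"
      unfolding \<phi>'(3) *(3) by (intro sat_cong) auto
  qed
qed

lemma formula_imp_definable:
  assumes "(\<phi>, c) \<in> formulas L A n"
  obtains P where "definable L M {..<n} A P" "\<And>u. length u = n \<Longrightarrow> holds M (\<phi>, c) u = P (nth u)"
proof -
  define \<sigma> where "\<sigma> i = (if i < n then Inl i else Inr (c ! (i - n)))" for i
  define P where "P e = sat M (\<lambda>i. value_in e (\<sigma> i)) \<phi>" for e
  have \<phi>: "wf_fm L \<phi>" "set c \<subseteq> A" "fv \<phi> \<subseteq> {..<n + length c}"
    using assms by (auto simp: formulas_def)
  have "\<sigma> i \<in> {..<n} <+> A" if "i \<in> fv \<phi>" for i
    using that \<phi>(2,3) nth_mem[of "i - n" c] unfolding \<sigma>_def by fastforce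
  then have "definable L M {..<n} A P"
    using \<phi>(1) by (intro definableI[of L \<phi> \<sigma>]) (auto simp: P_def)
  moreover have "holds M (\<phi>, c) u = P (nth u)" if "length u = n" for u
    using that by (auto simp: holds_def P_def \<sigma>_def nth_append intro!: sat_cong)
  ultimately show thesis by (rule that)
qed

lemma tp_eq_iff:
  assumes "length u = length v"
  shows "tp L M u A = tp L M v A \<longleftrightarrow>
    (\<forall>P. definable L M {..<length v} A P \<longrightarrow> P (nth u) = P (nth v))"
proof (rule iffI, intro allI impI)
  fix P assume eq: "tp L M u A = tp L M v A" and P: "definable L M {..<length v} A P"
  obtain \<phi> c where \<phi>: "wf_fm L \<phi>" "set c \<subseteq> A" "fv \<phi> \<subseteq> {..<length v + length c}"
    "\<And>u. length u = length v \<Longrightarrow> sat M (\<lambda>i. (u @ c) ! i) \<phi> = P (nth u)"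
    using definable_imp_formula[OF P] by blast
  then have "(\<phi>, c) \<in> formulas L A (length v)" by (auto simp: formulas_def)
  then have "holds M (\<phi>, c) u = holds M (\<phi>, c) v"
    using eq assms by (auto simp: tp_def)
  then show "P (nth u) = P (nth v)" using \<phi>(4) assms by (simp add: holds_def)
next
  assume *: "\<forall>P. definable L M {..<length v} A P \<longrightarrow> P (nth u) = P (nth v)"
  have "holds M p u = holds M p v" if p: "p \<in> formulas L A (length v)" for p
  proof -
    obtain \<phi> c where "p = (\<phi>, c)" by (cases p)
    with p obtain P where "definable L M {..<length v} A P"
        "\<And>u. length u = length v \<Longrightarrow> holds M p u = P (nth u)"
      using formula_imp_definable[of \<phi> c L A "length v" M] by blast
    then show ?thesis using * assms by simp
  qed
  then have "p \<in> tp L M u A \<longleftrightarrow> p \<in> tp L M v A" for p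
    using assms by (cases p) (auto simp: tp_def)
  then show "tp L M u A = tp L M v A" by blast
qed

text \<open>Formulas are closed under negation, so realizing a complete type amounts to having it.\<close>

lemma realizations_tp_iff:
  "u \<in> realizations M (length v) (tp L M v A) \<longleftrightarrow>
     u \<in> tuples M (length v) \<and> tp L M u A = tp L M v A"
proof safe
  assume u: "u \<in> realizations M (length v) (tp L M v A)"
  then show ut: "u \<in> tuples M (length v)" by (simp add: realizations_def)
  then have len: "length u = length v" by (simp add: tuples_def)
  have Pu: "P (nth u)" if P: "definable L M {..<length v} A P" "P (nth v)" for P
  proof -
    obtain \<phi> c where \<phi>: "wf_fm L \<phi>" "set c \<subseteq> A" "fv \<phi> \<subseteq> {..<length v + length c}"
      "\<And>u. length u = length v \<Longrightarrow> sat M (\<lambda>i. (u @ c) ! i) \<phi> = P (nth u)"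
      using definable_imp_formula[OF P(1)] by blast
    then have "(\<phi>, c) \<in> tp L M v A" using P(2) by (auto simp: tp_def formulas_def holds_def)
    then have "holds M (\<phi>, c) u" using u by (auto simp: realizations_def)
    then show ?thesis using \<phi>(4) len by (simp add: holds_def)
  qed
  have "P (nth u) = P (nth v)" if P: "definable L M {..<length v} A P" for P
    using Pu[OF P] Pu[OF definable_Neg[OF P]] by blast
  then have "tp L M u A = tp L M v A" using tp_eq_iff[OF len] by blast
  then show "\<And>a b. (a, b) \<in> tp L M u A \<Longrightarrow> (a, b) \<in> tp L M v A"
    "\<And>a b. (a, b) \<in> tp L M v A \<Longrightarrow> (a, b) \<in> tp L M u A" by auto
next
  assume "u \<in> tuples M (length v)" "tp L M u A = tp L M v A"
  moreover from this have "p \<in> tp L M v A \<Longrightarrow> holds M p u" for p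
    unfolding tp_def by blast
  ultimately show "u \<in> realizations M (length v) (tp L M v A)"
    by (auto simp: realizations_def)
qed


section \<open>Compactness for countably many variables\<close>

locale monster =
  fixes L :: "('f, 'r) language" and T :: "('f, 'r) fm set"
    and \<kappa> :: "'k rel" and M :: "('f, 'r, 'a) struct"
  assumes monster: "monster_model L T \<kappa> M"
begin

lemma univ_ne: "univ M \<noteq> {}"
  using monster by (auto simp: monster_model_def is_model_def is_structure_def)

lemma small_subset_univ: "small \<kappa> M A \<Longrightarrow> A \<subseteq> univ M"
  by (simp add: small_def)

lemma small_Un_countable:
  assumes "small \<kappa> M A" "countable C" "C \<subseteq> univ M"
  shows "small \<kappa> M (A \<union> C)"
proof -
  have "inj (\<lambda>i. Eq (Var i) (Var i) :: ('f, 'r) fm)" by (auto simp: inj_def)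
  moreover have "range (\<lambda>i. Eq (Var i) (Var i)) \<subseteq> {\<phi> :: ('f, 'r) fm. wf_fm L \<phi>}" by auto
  ultimately have "|UNIV :: nat set| \<le>o |{\<phi>. wf_fm L \<phi>}|"
    using card_of_ordLeq by blast
  moreover have \<kappa>: "Card_order \<kappa>" "|{\<phi>. wf_fm L \<phi>}| <o \<kappa>"
    using monster by (auto simp: monster_model_def)
  ultimately have nat: "|UNIV :: nat set| <o \<kappa>"
    using ordLeq_ordLess_trans by blast
  have "|C| \<le>o |UNIV :: nat set|"
    using assms(2) card_of_ordLeq[of C "UNIV :: nat set"] unfolding countable_def by auto
  then have C: "|C| <o \<kappa>" using nat ordLeq_ordLess_trans by blast
  have "infinite (Field \<kappa>)"
  proof -
    have "|UNIV :: nat set| \<le>o |Field \<kappa>|"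
      using nat card_of_Field_ordIso[OF \<kappa>(1)] ordLess_imp_ordLeq ordIso_symmetric
        ordLeq_ordIso_trans by blast
    then show ?thesis using card_of_ordLeq_infinite infinite_UNIV_nat by blast
  qed
  then show ?thesis
    using card_of_Un_ordLess_infinite_Field[of \<kappa> A C] \<kappa> C assms by (auto simp: small_def)
qed

text \<open>Saturation only speaks of finitely many variables. Values for countably many are found one
  after the other, keeping every finite part of \<open>\<Sigma>\<close> satisfiable by some continuation.\<close>

lemma compactness_nat:
  fixes \<Sigma> :: "((nat \<Rightarrow> 'a) \<Rightarrow> bool) set"
  assumes A: "small \<kappa> M A"
    and def: "\<And>P. P \<in> \<Sigma> \<Longrightarrow> definable L M UNIV A P"
    and fin: "\<And>\<Sigma>0. finite \<Sigma>0 \<Longrightarrow> \<Sigma>0 \<subseteq> \<Sigma> \<Longrightarrow> \<exists>e. range e \<subseteq> univ M \<and> (\<forall>P\<in>\<Sigma>0. P e)"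
  shows "\<exists>e. range e \<subseteq> univ M \<and> (\<forall>P\<in>\<Sigma>. P e)"
proof -
  define ok where "ok n x \<longleftrightarrow> (\<forall>i<n. x i \<in> univ M) \<and> (\<forall>\<Sigma>0. finite \<Sigma>0 \<longrightarrow> \<Sigma>0 \<subseteq> \<Sigma> \<longrightarrow>
      (\<exists>e. range e \<subseteq> univ M \<and> (\<forall>i<n. e i = x i) \<and> (\<forall>P\<in>\<Sigma>0. P e)))" for n :: nat and x
  have step: "\<exists>y. ok (Suc n) y \<and> (\<forall>i<n. y i = x i)" if ok: "ok n x" for n x
  proof -
    define B where "B = A \<union> x ` {..<n}"
    have B: "small \<kappa> M B"
      unfolding B_def using ok by (intro small_Un_countable A) (auto simp: ok_def)
    define Q where "Q \<Sigma>0 e \<longleftrightarrow> (\<exists>e'. (\<forall>v. v \<notin> {n<..} \<longrightarrow> e' v = e v) \<and> e' ` {n<..} \<subseteq> univ M \<and>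
        (\<forall>P\<in>\<Sigma>0. P e'))" for \<Sigma>0 :: "((nat \<Rightarrow> 'a) \<Rightarrow> bool) set" and e
    define s :: "nat \<Rightarrow> nat + 'a" where "s i = (if i = n then Inl 0 else Inr (x i))" for i
    define R where "R \<Sigma>0 e \<longleftrightarrow> Q \<Sigma>0 (\<lambda>i. value_in e (s i))"
      for \<Sigma>0 and e :: "nat \<Rightarrow> 'a"
    have "\<exists>p. p \<in> formulas L B 1 \<and> (\<forall>u. length u = 1 \<longrightarrow> holds M p u = R \<Sigma>0 (nth u))"
      if "finite \<Sigma>0" "\<Sigma>0 \<subseteq> \<Sigma>" for \<Sigma>0
    proof -
      have "definable L M UNIV A (\<lambda>e. \<forall>P\<in>\<Sigma>0. P e)"
        using that def by (intro definable_Ball univ_ne) auto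
      then have "definable L M (UNIV - {n<..}) A (Q \<Sigma>0)"
        unfolding Q_def[abs_def] by (intro definable_project univ_ne)
      then have "definable L M {..<1} B (R \<Sigma>0)" unfolding R_def[abs_def]
        by (rule definable_subst) (auto simp: s_def B_def)
      from definable_imp_formula[OF this] obtain \<phi> c where "wf_fm L \<phi>" "set c \<subseteq> B"
          "fv \<phi> \<subseteq> {..<1 + length c}"
          "\<And>u. length u = 1 \<Longrightarrow> sat M (\<lambda>i. (u @ c) ! i) \<phi> = R \<Sigma>0 (nth u)"
        by blast
      then show ?thesis by (intro exI[of _ "(\<phi>, c)"]) (simp add: formulas_def holds_def)
    qed
    then obtain p where p: "\<And>\<Sigma>0. finite \<Sigma>0 \<Longrightarrow> \<Sigma>0 \<subseteq> \<Sigma> \<Longrightarrow> p \<Sigma>0 \<in> formulas L B 1"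
        "\<And>\<Sigma>0 u. finite \<Sigma>0 \<Longrightarrow> \<Sigma>0 \<subseteq> \<Sigma> \<Longrightarrow> length u = 1 \<Longrightarrow> holds M (p \<Sigma>0) u = R \<Sigma>0 (nth u)"
      by metis
    define \<Gamma> where "\<Gamma> = p ` {\<Sigma>0. finite \<Sigma>0 \<and> \<Sigma>0 \<subseteq> \<Sigma>}"
    have "realizations M 1 \<Gamma>0 \<noteq> {}" if fin0: "finite \<Gamma>0" "\<Gamma>0 \<subseteq> \<Gamma>" for \<Gamma>0
    proof -
      obtain X where X: "X \<subseteq> {\<Sigma>0. finite \<Sigma>0 \<and> \<Sigma>0 \<subseteq> \<Sigma>}" "finite X" "\<Gamma>0 = p ` X"
        using finite_subset_image[OF fin0(1) fin0(2)[unfolded \<Gamma>_def]] by blast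
      then have "finite (\<Union>X)" "\<Union>X \<subseteq> \<Sigma>" by auto
      then obtain e where e: "range e \<subseteq> univ M" "\<And>i. i < n \<Longrightarrow> e i = x i" "\<And>P. P \<in> \<Union>X \<Longrightarrow> P e"
        using ok unfolding ok_def by meson
      have "holds M (p \<Sigma>0) [e n]" if "\<Sigma>0 \<in> X" for \<Sigma>0
      proof -
        have "Q \<Sigma>0 (\<lambda>i. value_in (nth [e n]) (s i))"
          unfolding Q_def using e that by (intro exI[of _ e]) (auto simp: s_def)
        then show ?thesis using that X(1) p(2)[of \<Sigma>0 "[e n]"] by (auto simp: R_def)
      qed
      then have "[e n] \<in> realizations M 1 \<Gamma>0"
        using e(1) by (auto simp: realizations_def tuples_def X(3))
      then show ?thesis by blast
    qed
    moreover have "\<Gamma> \<subseteq> formulas L B 1" using p(1) by (auto simp: \<Gamma>_def)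
    moreover have "saturated L \<kappa> M" using monster by (simp add: monster_model_def)
    ultimately obtain u where u: "u \<in> realizations M 1 \<Gamma>"
      using B unfolding saturated_def by (meson ex_in_conv)
    then have lu: "length u = 1" "u ! 0 \<in> univ M"
      by (auto simp: realizations_def tuples_def)
    have "\<exists>e. range e \<subseteq> univ M \<and> (\<forall>i<Suc n. e i = (x(n := u ! 0)) i) \<and> (\<forall>P\<in>\<Sigma>0. P e)"
      if "finite \<Sigma>0" "\<Sigma>0 \<subseteq> \<Sigma>" for \<Sigma>0
    proof -
      have "R \<Sigma>0 (nth u)" using u that p(2)[OF that lu(1)] by (auto simp: realizations_def \<Gamma>_def)
      then obtain e where e: "\<forall>v. v \<notin> {n<..} \<longrightarrow> e v = value_in (nth u) (s v)"
          "e ` {n<..} \<subseteq> univ M" "\<forall>P\<in>\<Sigma>0. P e"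
        unfolding R_def Q_def by blast
      have "e i \<in> univ M" for i
        using e(1,2) lu(2) ok by (cases i n rule: linorder_cases) (auto simp: s_def ok_def)
      then show ?thesis using e by (intro exI[of _ e]) (auto simp: s_def)
    qed
    then have "ok (Suc n) (x(n := u ! 0))"
      using ok lu(2) unfolding ok_def by (auto simp: less_Suc_eq)
    then show ?thesis by (intro exI[of _ "x(n := u ! 0)"]) auto
  qed
  have "\<exists>x. ok 0 x" using fin by (auto simp: ok_def)
  then obtain f where f: "\<And>n. ok n (f n)" "\<And>n i. i < n \<Longrightarrow> f (Suc n) i = f n i"
    using dependent_nat_choice[of ok "\<lambda>n x y. \<forall>i<n. y i = x i"] step by metis
  define e where "e i = f (Suc i) i" for i
  have fe: "f n i = e i" if "i < n" for n i
    using that by (induction n) (auto simp: f(2) e_def less_Suc_eq)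
  have "P e" if P: "P \<in> \<Sigma>" for P
  proof -
    obtain V0 where V0: "finite V0" "definable L M V0 A P"
      by (rule definable_finite_support[OF def[OF P]])
    obtain n where n: "\<And>v. v \<in> V0 \<Longrightarrow> v < n"
      using V0(1) unfolding finite_nat_set_iff_bounded by auto
    obtain e' where "\<And>i. i < n \<Longrightarrow> e' i = f n i" "P e'"
      using f(1)[of n, unfolded ok_def, THEN conjunct2, rule_format, of "{P}"] P by auto
    then show ?thesis using definable_cong[OF V0(2), of e' e] n fe by auto
  qed
  moreover have "range e \<subseteq> univ M" using f(1) unfolding ok_def e_def by auto
  ultimately show ?thesis by blast
qed

lemma compactness:
  fixes \<Sigma> :: "(('v::countable \<Rightarrow> 'a) \<Rightarrow> bool) set"
  assumes A: "small \<kappa> M A"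
    and def: "\<And>P. P \<in> \<Sigma> \<Longrightarrow> definable L M UNIV A P"
    and fin: "\<And>\<Sigma>0. finite \<Sigma>0 \<Longrightarrow> \<Sigma>0 \<subseteq> \<Sigma> \<Longrightarrow> \<exists>e. range e \<subseteq> univ M \<and> (\<forall>P\<in>\<Sigma>0. P e)"
  shows "\<exists>e. range e \<subseteq> univ M \<and> (\<forall>P\<in>\<Sigma>. P e)"
proof -
  define F where "F P e \<longleftrightarrow> P (\<lambda>v. e (to_nat v))"
    for P :: "('v \<Rightarrow> 'a) \<Rightarrow> bool" and e :: "nat \<Rightarrow> 'a"
  have "\<exists>e. range e \<subseteq> univ M \<and> (\<forall>P\<in>F ` \<Sigma>. P e)"
  proof (rule compactness_nat[OF A])
    show "definable L M UNIV A P" if P: "P \<in> F ` \<Sigma>" for P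
    proof -
      obtain P' where "P' \<in> \<Sigma>" "P = F P'" using P by blast
      then show ?thesis
        using definable_reindex[OF def[of P'], of to_nat UNIV] by (simp add: F_def[abs_def])
    qed
  next
    fix \<Sigma>0 assume "finite \<Sigma>0" "\<Sigma>0 \<subseteq> F ` \<Sigma>"
    then obtain X where "X \<subseteq> \<Sigma>" "finite X" "\<Sigma>0 = F ` X"
      using finite_subset_image[of \<Sigma>0 F \<Sigma>] by blast
    moreover from this obtain e where "range e \<subseteq> univ M" "\<forall>P\<in>X. P e"
      using fin by blast
    ultimately show "\<exists>e. range e \<subseteq> univ M \<and> (\<forall>P\<in>\<Sigma>0. P e)"
      by (intro exI[of _ "\<lambda>n. e (from_nat n)"]) (auto simp: F_def)
  qed
  then obtain e where "range e \<subseteq> univ M" "\<forall>P\<in>\<Sigma>. F P e" by blast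
  then show ?thesis by (intro exI[of _ "\<lambda>v. e (to_nat v)"]) (auto simp: F_def)
qed

end


section \<open>Indiscernibility as invariance under changes of position\<close>

definition same_order :: "'i set \<Rightarrow> ('i \<Rightarrow> 'p::linorder) \<Rightarrow> ('i \<Rightarrow> 'q::linorder) \<Rightarrow> bool" where
  "same_order X f g \<longleftrightarrow> (\<forall>x\<in>X. \<forall>y\<in>X. f x < f y \<longleftrightarrow> g x < g y)"

lemma same_order_sym: "same_order X f g \<Longrightarrow> same_order X g f"
  by (simp add: same_order_def)

lemma same_order_trans: "same_order X f g \<Longrightarrow> same_order X g h \<Longrightarrow> same_order X f h"
  by (simp add: same_order_def)

lemma same_order_subset: "same_order X f g \<Longrightarrow> Y \<subseteq> X \<Longrightarrow> same_order Y f g"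
  by (auto simp: same_order_def)

lemma same_order_comp:
  assumes "same_order (f ` X) h (\<lambda>q. q)"
  shows "same_order X (\<lambda>x. h (f x)) f"
  using assms by (auto simp: same_order_def)

lemma same_order_eq:
  assumes "same_order X f g" "x \<in> X" "y \<in> X"
  shows "f x = f y \<longleftrightarrow> g x = g y"
  using assms unfolding same_order_def by (metis linorder_neq_iff)

lemma same_order_card_image:
  assumes "same_order X f g"
  shows "card (f ` X) = card (g ` X)"
proof -
  define h where "h q = g (inv_into X f q)" for q
  have h: "h (f x) = g x" if "x \<in> X" for x
    using that same_order_eq[OF assms, of "inv_into X f (f x)" x]
    by (auto simp: h_def f_inv_into_f inv_into_into)
  have "inj_on h (f ` X)"
    using same_order_eq[OF assms] by (auto simp: inj_on_def h)
  moreover have "h ` f ` X = g ` X" by (auto simp: h image_image)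
  ultimately show ?thesis by (metis card_image)
qed

lemma same_order_rank:
  assumes "same_order X f g" "x \<in> X"
  shows "card {q \<in> f ` X. q < f x} = card {q \<in> g ` X. q < g x}"
proof -
  have "{q \<in> f ` X. q < f x} = f ` {y \<in> X. f y < f x}"
    "{q \<in> g ` X. q < g x} = g ` {y \<in> X. f y < f x}"
    using assms by (auto simp: same_order_def)
  moreover have "same_order {y \<in> X. f y < f x} f g"
    using assms by (auto simp: same_order_def)
  ultimately show ?thesis by (simp add: same_order_card_image)
qed

lemma same_order_rank_self:
  assumes "finite Q"
  shows "same_order Q (\<lambda>q. card {x \<in> Q. x < q}) (\<lambda>q::'q::linorder. q)"
proof -
  have less: "card {x \<in> Q. x < p} < card {x \<in> Q. x < q}" if "p < q" "p \<in> Q" for p q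
    using that assms by (intro psubset_card_mono) auto
  show ?thesis unfolding same_order_def
  proof (intro ballI)
    fix p q assume "p \<in> Q" "q \<in> Q"
    then show "card {x \<in> Q. x < p} < card {x \<in> Q. x < q} \<longleftrightarrow> p < q"
      using less[of p q] less[of q p] by (cases p q rule: linorder_cases) auto
  qed
qed

lemma sorted_list_of_set_nth_rank:
  fixes Q :: "'q::linorder set"
  assumes "finite Q" "q \<in> Q"
  shows "card {x \<in> Q. x < q} < card Q"
    and "sorted_list_of_set Q ! card {x \<in> Q. x < q} = q"
proof -
  define xs where "xs = sorted_list_of_set Q"
  have xs: "set xs = Q" "sorted_wrt (<) xs" "distinct xs"
    using assms(1) by (auto simp: xs_def)
  obtain n where n: "n < length xs" "xs ! n = q"
    using assms(2) xs(1) by (metis in_set_conv_nth)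
  have "{x \<in> Q. x < q} = nth xs ` {..<n}"
  proof
    show "{x \<in> Q. x < q} \<subseteq> nth xs ` {..<n}"
    proof
      fix x assume x: "x \<in> {x \<in> Q. x < q}"
      then obtain m where m: "m < length xs" "xs ! m = x"
        using xs(1) by (metis in_set_conv_nth mem_Collect_eq)
      have "m < n"
        using x m n sorted_wrt_nth_less[OF xs(2), of n m]
        by (metis linorder_neqE_nat mem_Collect_eq order_less_asym)
      then show "x \<in> nth xs ` {..<n}" using m by auto
    qed
    show "nth xs ` {..<n} \<subseteq> {x \<in> Q. x < q}"
      using n xs(1) sorted_wrt_nth_less[OF xs(2)] by auto
  qed
  moreover have "inj_on (nth xs) {..<n}"
    using xs(3) n(1) by (auto simp: inj_on_def nth_eq_iff_index_eq)
  ultimately have "card {x \<in> Q. x < q} = n" by (simp add: card_image)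
  then show "sorted_list_of_set Q ! card {x \<in> Q. x < q} = q"
    using n by (simp add: xs_def)
  show "card {x \<in> Q. x < q} < card Q"
    using assms by (intro psubset_card_mono) auto
qed

lemma nth_concat_map:
  assumes "\<And>i. length (I i) = l" "r < length is" "t < l"
  shows "concat (map I is) ! (r * l + t) = I (is ! r) ! t"
  using assms(2)
proof (induction "is" arbitrary: r)
  case (Cons i "is")
  then show ?case using assms(1,3) by (cases r) (auto simp: nth_append)
qed simp

lemma length_concat_map:
  assumes "\<And>i. length (I i) = l"
  shows "length (concat (map I is)) = length is * l"
  using assms by (induction "is") auto

text \<open>Here \<open>K\<close> tells which coordinate or parameter each variable stands for, and \<open>pos\<close> at which
  member of the sequence the coordinate is read. In this form the lists of positions in the
  definition, which have to be increasing, are replaced by arbitrary maps.\<close>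

lemma indiscernible_iff:
  assumes I: "\<And>m. I m \<in> tuples M l"
  shows "indiscernible L M B I \<longleftrightarrow> (\<forall>\<phi> K pos pos'. wf_fm L \<phi> \<longrightarrow> K ` fv \<phi> \<subseteq> {..<l} <+> B \<longrightarrow>
    same_order {i \<in> fv \<phi>. isl (K i)} pos pos' \<longrightarrow>
    sat M (\<lambda>i. value_in (nth (I (pos i))) (K i)) \<phi> =
    sat M (\<lambda>i. value_in (nth (I (pos' i))) (K i)) \<phi>)" (is "_ \<longleftrightarrow> ?R")
proof
  have len: "length (I m) = l" for m using I by (simp add: tuples_def)
  assume ind: "indiscernible L M B I"
  show ?R
  proof (intro allI impI)
    fix \<phi> K and pos pos' :: "nat \<Rightarrow> nat"
    assume \<phi>: "wf_fm L \<phi>" "K ` fv \<phi> \<subseteq> {..<l} <+> B"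
      and ord: "same_order {i \<in> fv \<phi>. isl (K i)} pos pos'"
    define X where "X = {i \<in> fv \<phi>. isl (K i)}"
    have X: "finite X" "same_order X pos pos'" using finite_fv[of \<phi>] ord by (auto simp: X_def)
    define "is" where "is = sorted_list_of_set (pos ` X)"
    define js where "js = sorted_list_of_set (pos' ` X)"
    define r where "r i = card {q \<in> pos ` X. q < pos i}" for i
    have r': "r i = card {q \<in> pos' ` X. q < pos' i}" if "i \<in> X" for i
      using same_order_rank[OF X(2) that] by (simp add: r_def)
    have lens: "length is = card (pos ` X)" "length js = card (pos ` X)"
      using same_order_card_image[OF X(2)] by (simp_all add: is_def js_def)
    have r: "r i < length is" "is ! r i = pos i" "js ! r i = pos' i" if "i \<in> X" for i
      using sorted_list_of_set_nth_rank[of "pos ` X" "pos i"]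
        sorted_list_of_set_nth_rank[of "pos' ` X" "pos' i"] that X(1) r'[OF that]
      by (auto simp: r_def[symmetric] is_def js_def)
    define \<sigma> where "\<sigma> i = case_sum (\<lambda>t. Inl (r i * l + t)) Inr (K i)" for i
    define P where "P e = sat M (\<lambda>i. value_in e (\<sigma> i)) \<phi>" for e
    have \<sigma>: "(\<exists>t<l. K i = Inl t \<and> \<sigma> i = Inl (r i * l + t) \<and> i \<in> X \<and> r i * l + t < length js * l) \<or>
        (\<exists>c\<in>B. K i = Inr c \<and> \<sigma> i = Inr c)" if "i \<in> fv \<phi>" for i
    proof (cases "K i")
      case (Inl t)
      then have "t < l" "i \<in> X" using that \<phi>(2) by (auto simp: X_def image_subset_iff)
      moreover have "Suc (r i) * l \<le> length is * l"
        using r(1)[OF \<open>i \<in> X\<close>] by (intro mult_le_mono1) simp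
      ultimately show ?thesis using Inl lens by (auto simp: \<sigma>_def)
    next
      case (Inr c)
      then show ?thesis using that \<phi>(2) by (force simp: \<sigma>_def image_subset_iff)
    qed
    have Pdef: "definable L M {..<length js * l} B P"
    proof (rule definableI[OF \<phi>(1), of \<sigma>])
      have "\<sigma> i \<in> {..<length js * l} <+> B" if "i \<in> fv \<phi>" for i
        using \<sigma>[OF that] by auto
      then show "\<sigma> ` fv \<phi> \<subseteq> {..<length js * l} <+> B" by blast
    qed (simp add: P_def)
    have P1: "P (nth (concat (map I is))) = sat M (\<lambda>i. value_in (nth (I (pos i))) (K i)) \<phi>"
      unfolding P_def
    proof (rule sat_cong)
      fix i assume "i \<in> fv \<phi>"
      then show "value_in (nth (concat (map I is))) (\<sigma> i) = value_in (nth (I (pos i))) (K i)"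
        using \<sigma>[of i] r[of i] lens by (auto simp: nth_concat_map[of I l] len)
    qed
    have P2: "P (nth (concat (map I js))) = sat M (\<lambda>i. value_in (nth (I (pos' i))) (K i)) \<phi>"
      unfolding P_def
    proof (rule sat_cong)
      fix i assume "i \<in> fv \<phi>"
      then show "value_in (nth (concat (map I js))) (\<sigma> i) = value_in (nth (I (pos' i))) (K i)"
        using \<sigma>[of i] r[of i] lens by (auto simp: nth_concat_map[of I l] len)
    qed
    have "tp L M (concat (map I is)) B = tp L M (concat (map I js)) B"
      using ind lens X(1) unfolding indiscernible_def by (auto simp: is_def js_def)
    then have "P (nth (concat (map I is))) = P (nth (concat (map I js)))"
      using Pdef lens tp_eq_iff[of "concat (map I is)" "concat (map I js)" L M B]
      by (simp add: length_concat_map[of I l] len)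
    then show "sat M (\<lambda>i. value_in (nth (I (pos i))) (K i)) \<phi> =
        sat M (\<lambda>i. value_in (nth (I (pos' i))) (K i)) \<phi>"
      unfolding P1 P2 .
  qed
next
  have len: "length (I m) = l" for m using I by (simp add: tuples_def)
  assume R: ?R
  have "tp L M (concat (map I is)) B = tp L M (concat (map I js)) B"
    if s: "sorted_wrt (<) is" "sorted_wrt (<) js" "length is = length js" for "is" js
  proof -
    have "P (nth (concat (map I is))) = P (nth (concat (map I js)))"
      if P: "definable L M {..<length js * l} B P" for P
    proof -
      obtain \<phi> \<sigma> where \<phi>: "wf_fm L \<phi>" "\<sigma> ` fv \<phi> \<subseteq> {..<length js * l} <+> B"
        "P = (\<lambda>e. sat M (\<lambda>i. value_in e (\<sigma> i)) \<phi>)"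
        using P unfolding definable_def by blast
      define K where "K i = map_sum (\<lambda>p. p mod l) id (\<sigma> i)" for i
      define pos where "pos ks i = case_sum (\<lambda>p. ks ! (p div l)) (\<lambda>_. 0) (\<sigma> i)"
        for ks :: "nat list" and i
      have \<sigma>: "(\<exists>p. \<sigma> i = Inl p \<and> p div l < length js \<and> p mod l < l) \<or> (\<exists>c\<in>B. \<sigma> i = Inr c)"
        if "i \<in> fv \<phi>" for i
      proof (cases "\<sigma> i")
        case (Inl p)
        then have "p < length js * l" using that \<phi>(2) by (auto simp: image_subset_iff)
        then show ?thesis using Inl
          by (auto simp: less_mult_imp_div_less intro!: mod_less_divisor gr0I)
      next
        case (Inr c)
        then show ?thesis using that \<phi>(2) by (force simp: image_subset_iff)
      qed
      have eq: "value_in (nth (concat (map I ks))) (\<sigma> i) = value_in (nth (I (pos ks i))) (K i)"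
        if "i \<in> fv \<phi>" "length ks = length js" for i ks
        using \<sigma>[OF that(1)] nth_concat_map[of I l _ ks] that(2)
        by (auto simp: K_def pos_def len) (metis div_mult_mod_eq)
      have mono: "a < b \<longleftrightarrow> ks ! a < ks ! b"
        if "a < length js" "b < length js" "length ks = length js" "sorted_wrt (<) ks"
        for a b and ks :: "nat list"
        using that sorted_wrt_nth_less[OF that(4), of a b] sorted_wrt_nth_less[OF that(4), of b a]
        by (metis linorder_neqE_nat order_less_asym)
      have "same_order {i \<in> fv \<phi>. isl (K i)} (pos is) (pos js)"
        unfolding same_order_def
      proof (intro ballI)
        fix i i' assume "i \<in> {i \<in> fv \<phi>. isl (K i)}" "i' \<in> {i \<in> fv \<phi>. isl (K i)}"
        then obtain p p' where "\<sigma> i = Inl p" "p div l < length js" "\<sigma> i' = Inl p'" "p' div l < length js"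
          using \<sigma>[of i] \<sigma>[of i'] by (auto simp: K_def)
        then show "pos is i < pos is i' \<longleftrightarrow> pos js i < pos js i'"
          using mono[of "p div l" "p' div l" "is"] mono[of "p div l" "p' div l" js] s
          by (simp add: pos_def)
      qed
      moreover have "K ` fv \<phi> \<subseteq> {..<l} <+> B"
      proof
        fix x assume "x \<in> K ` fv \<phi>"
        then obtain i where "x = K i" "i \<in> fv \<phi>" by blast
        then show "x \<in> {..<l} <+> B" using \<sigma>[of i] by (auto simp: K_def)
      qed
      ultimately have "sat M (\<lambda>i. value_in (nth (I (pos is i))) (K i)) \<phi> =
          sat M (\<lambda>i. value_in (nth (I (pos js i))) (K i)) \<phi>"
        using R \<phi>(1) by blast
      moreover have "P (nth (concat (map I ks))) =
          sat M (\<lambda>i. value_in (nth (I (pos ks i))) (K i)) \<phi>"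
        if "length ks = length js" for ks
        unfolding \<phi>(3) using eq that by (intro sat_cong) blast
      ultimately show ?thesis using s(3) by blast
    qed
    then show ?thesis
      using s(3) by (subst tp_eq_iff) (auto simp: length_concat_map[of I l] len)
  qed
  moreover have "sequence M I" using I by (auto simp: sequence_def)
  ultimately show "indiscernible L M B I" by (auto simp: indiscernible_def)
qed

text \<open>Equality of Ehrenfeucht-Mostowski types over \<open>A\<close>. The index orders may differ, which allows
  sequences to be compared with an array of blocks; the case \<open>I = G\<close> is mutual indiscernibility.\<close>

definition same_EM_type :: "('f, 'r) language \<Rightarrow> ('f, 'r, 'a) struct \<Rightarrow> 'a set \<Rightarrow> 'j set \<Rightarrow>
    ('j \<Rightarrow> nat) \<Rightarrow> ('j \<Rightarrow> 'p::linorder \<Rightarrow> 'a list) \<Rightarrow> ('j \<Rightarrow> 'q::linorder \<Rightarrow> 'a list) \<Rightarrow> bool" where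
  "same_EM_type L M A J l I G \<longleftrightarrow> (\<forall>\<phi> K pos pos'. wf_fm L \<phi> \<longrightarrow>
    K ` fv \<phi> \<subseteq> Sigma J (\<lambda>j. {..<l j}) <+> A \<longrightarrow>
    (\<forall>j. same_order {i \<in> fv \<phi>. \<exists>t. K i = Inl (j, t)} pos pos') \<longrightarrow>
    sat M (\<lambda>i. value_in (\<lambda>(j, t). I j (pos i) ! t) (K i)) \<phi> =
    sat M (\<lambda>i. value_in (\<lambda>(j, t). G j (pos' i) ! t) (K i)) \<phi>)"

lemma mutually_indiscernible_iff:
  assumes I: "\<And>j m. j \<in> J \<Longrightarrow> I j m \<in> tuples M (l j)"
  shows "mutually_indiscernible L M A J I \<longleftrightarrow> same_EM_type L M A J l I I"
proof
  assume mut: "mutually_indiscernible L M A J I"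
  \<comment> \<open>The positions are changed in one sequence after the other.\<close>
  have main: "sat M (\<lambda>i. value_in (\<lambda>(j, t). I j (pos i) ! t) (K i)) \<phi> =
      sat M (\<lambda>i. value_in (\<lambda>(j, t). I j (pos' i) ! t) (K i)) \<phi>"
    if "finite J0" "J0 \<subseteq> J" "wf_fm L \<phi>" "K ` fv \<phi> \<subseteq> Sigma J (\<lambda>j. {..<l j}) <+> A"
      "\<forall>j. same_order {i \<in> fv \<phi>. \<exists>t. K i = Inl (j, t)} pos pos'"
      "\<forall>i\<in>fv \<phi>. \<forall>j t. K i = Inl (j, t) \<longrightarrow> j \<notin> J0 \<longrightarrow> pos i = pos' i"
    for J0 \<phi> K and pos pos' :: "nat \<Rightarrow> nat"
    using that
  proof (induction J0 arbitrary: pos)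
    case empty
    then show ?case by (intro sat_cong) (auto simp: value_in_def split: sum.splits)
  next
    case (insert j J0)
    define pos'' where "pos'' i = (if \<exists>t. K i = Inl (j, t) then pos' i else pos i)" for i
    define B where "B = A \<union> (\<Union>\<beta>\<in>J - {j}. seq_elems (I \<beta>))"
    define K1 where "K1 i = (case K i of Inl (j', t) \<Rightarrow>
        if j' = j then Inl t else Inr (I j' (pos i) ! t) | Inr c \<Rightarrow> Inr c)" for i
    have j: "j \<in> J" using insert.prems by simp
    have K1: "K1 i \<in> {..<l j} <+> B" if "i \<in> fv \<phi>" for i
    proof (cases "K i")
      case (Inl p)
      obtain j' t where p: "p = (j', t)" by (cases p)
      then have t: "j' \<in> J" "t < l j'" using that insert.prems Inl by (auto simp: image_subset_iff)
      then have "I j' (pos i) ! t \<in> seq_elems (I j')"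
        using I[OF t(1), of "pos i"] by (auto simp: seq_elems_def tuples_def intro!: exI[of _ "pos i"])
      then show ?thesis using t Inl by (auto simp: K1_def B_def p)
    next
      case (Inr c)
      then show ?thesis using that insert.prems by (force simp: K1_def B_def image_subset_iff)
    qed
    have "isl (K1 i) \<longleftrightarrow> (\<exists>t. K i = Inl (j, t))" for i
      by (cases "K i") (auto simp: K1_def split: prod.splits)
    then have "same_order {i \<in> fv \<phi>. isl (K1 i)} pos pos'"
      using insert.prems(4) by simp
    moreover have "indiscernible L M B (I j)"
      using mut j by (simp add: mutually_indiscernible_def B_def)
    ultimately have "sat M (\<lambda>i. value_in (nth (I j (pos i))) (K1 i)) \<phi> =
        sat M (\<lambda>i. value_in (nth (I j (pos' i))) (K1 i)) \<phi>"
      using indiscernible_iff[of "I j" M "l j" L B] I[OF j] insert.prems(2) K1 by blast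
    moreover have "(\<lambda>i. value_in (nth (I j (pos i))) (K1 i)) =
        (\<lambda>i. value_in (\<lambda>(j, t). I j (pos i) ! t) (K i))"
      by (auto simp: fun_eq_iff K1_def split: sum.splits)
    moreover have "(\<lambda>i. value_in (nth (I j (pos' i))) (K1 i)) =
        (\<lambda>i. value_in (\<lambda>(j, t). I j (pos'' i) ! t) (K i))"
      by (auto simp: fun_eq_iff K1_def pos''_def split: sum.splits)
    ultimately have "sat M (\<lambda>i. value_in (\<lambda>(j, t). I j (pos i) ! t) (K i)) \<phi> =
        sat M (\<lambda>i. value_in (\<lambda>(j, t). I j (pos'' i) ! t) (K i)) \<phi>" by simp
    also have "\<dots> = sat M (\<lambda>i. value_in (\<lambda>(j, t). I j (pos' i) ! t) (K i)) \<phi>"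
    proof (rule insert.IH)
      show "J0 \<subseteq> J" "wf_fm L \<phi>" "K ` fv \<phi> \<subseteq> Sigma J (\<lambda>j. {..<l j}) <+> A"
        using insert.prems by auto
      show "\<forall>j. same_order {i \<in> fv \<phi>. \<exists>t. K i = Inl (j, t)} pos'' pos'"
        using insert.prems(4) by (auto simp: same_order_def pos''_def)
      show "\<forall>i\<in>fv \<phi>. \<forall>j t. K i = Inl (j, t) \<longrightarrow> j \<notin> J0 \<longrightarrow> pos'' i = pos' i"
        using insert.prems(5) by (auto simp: pos''_def)
    qed
    finally show ?case .
  qed
  show "same_EM_type L M A J l I I"
    unfolding same_EM_type_def
  proof (intro allI impI)
    fix \<phi> K and pos pos' :: "nat \<Rightarrow> nat"
    assume \<phi>: "wf_fm L \<phi>" "K ` fv \<phi> \<subseteq> Sigma J (\<lambda>j. {..<l j}) <+> A"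
      "\<forall>j. same_order {i \<in> fv \<phi>. \<exists>t. K i = Inl (j, t)} pos pos'"
    define J0 where "J0 = fst ` (Inl -` (K ` fv \<phi>))"
    have "finite J0"
      unfolding J0_def by (intro finite_imageI finite_vimageI finite_fv) simp
    moreover have "J0 \<subseteq> J" using \<phi>(2) by (auto simp: J0_def)
    moreover have "\<forall>i\<in>fv \<phi>. \<forall>j t. K i = Inl (j, t) \<longrightarrow> j \<in> J0"
      by (force simp: J0_def image_iff)
    ultimately show "sat M (\<lambda>i. value_in (\<lambda>(j, t). I j (pos i) ! t) (K i)) \<phi> =
        sat M (\<lambda>i. value_in (\<lambda>(j, t). I j (pos' i) ! t) (K i)) \<phi>"
      using main[of J0 \<phi> K pos pos'] \<phi> by blast
  qed
next
  assume EM: "same_EM_type L M A J l I I"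
  show "mutually_indiscernible L M A J I"
    unfolding mutually_indiscernible_def
  proof
    fix \<alpha> assume \<alpha>: "\<alpha> \<in> J"
    define B where "B = A \<union> (\<Union>\<beta>\<in>J - {\<alpha>}. seq_elems (I \<beta>))"
    have "\<exists>\<beta> m t. \<beta> \<in> J - {\<alpha>} \<and> t < l \<beta> \<and> I \<beta> m ! t = c" if "c \<in> B - A" for c
      using that I by (fastforce simp: B_def seq_elems_def in_set_conv_nth tuples_def)
    then obtain \<beta> m t where c: "\<And>c. c \<in> B - A \<Longrightarrow> \<beta> c \<in> J - {\<alpha>}"
        "\<And>c. c \<in> B - A \<Longrightarrow> t c < l (\<beta> c)" "\<And>c. c \<in> B - A \<Longrightarrow> I (\<beta> c) (m c) ! t c = c"
      by metis
    have "indiscernible L M B (I \<alpha>)"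
      unfolding indiscernible_iff[of "I \<alpha>" M "l \<alpha>" L B, OF I[OF \<alpha>]]
    proof (intro allI impI)
      fix \<phi> K and pos pos' :: "nat \<Rightarrow> nat"
      assume \<phi>: "wf_fm L \<phi>" "K ` fv \<phi> \<subseteq> {..<l \<alpha>} <+> B"
        "same_order {i \<in> fv \<phi>. isl (K i)} pos pos'"
      define K2 where "K2 i = (case K i of Inl t \<Rightarrow> Inl (\<alpha>, t) |
          Inr c \<Rightarrow> if c \<in> A then Inr c else Inl (\<beta> c, t c))" for i
      define pos2 where "pos2 q i = (case K i of Inl t \<Rightarrow> q i | Inr c \<Rightarrow> m c)"
        for q :: "nat \<Rightarrow> nat" and i
      have K2: "K2 i \<in> Sigma J (\<lambda>j. {..<l j}) <+> A \<and>
          value_in (\<lambda>(j, t). I j (pos2 q i) ! t) (K2 i) = value_in (nth (I \<alpha> (q i))) (K i)"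
        if "i \<in> fv \<phi>" for i q
      proof (cases "K i")
        case (Inl s)
        then have "s < l \<alpha>" using that \<phi>(2) by (auto simp: image_subset_iff)
        then show ?thesis using Inl \<alpha> by (auto simp: K2_def pos2_def)
      next
        case (Inr b)
        then have "b \<in> B" using that \<phi>(2) by (force simp: image_subset_iff)
        then show ?thesis using Inr c[of b] by (auto simp: K2_def pos2_def)
      qed
      have "same_order {i \<in> fv \<phi>. \<exists>t. K2 i = Inl (j, t)} (pos2 pos) (pos2 pos')" for j
      proof (cases "j = \<alpha>")
        case True
        have "isl (K i)" if "K2 i = Inl (\<alpha>, s)" "i \<in> fv \<phi>" for i s
        proof (cases "K i")
          case (Inr b)
          then have "b \<in> B" using that(2) \<phi>(2) by (force simp: image_subset_iff)
          then show ?thesis using Inr that(1) c(1)[of b] by (auto simp: K2_def split: if_splits)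
        qed simp
        then show ?thesis
          using \<phi>(3) True by (fastforce simp: same_order_def pos2_def split: sum.splits)
      next
        case False
        then show ?thesis
          by (auto simp: same_order_def pos2_def K2_def split: sum.splits)
      qed
      moreover have "K2 ` fv \<phi> \<subseteq> Sigma J (\<lambda>j. {..<l j}) <+> A"
        using K2 by blast
      ultimately have "sat M (\<lambda>i. value_in (\<lambda>(j, t). I j (pos2 pos i) ! t) (K2 i)) \<phi> =
          sat M (\<lambda>i. value_in (\<lambda>(j, t). I j (pos2 pos' i) ! t) (K2 i)) \<phi>"
        using EM \<phi>(1) unfolding same_EM_type_def by blast
      moreover have "sat M (\<lambda>i. value_in (\<lambda>(j, t). I j (pos2 q i) ! t) (K2 i)) \<phi> =
          sat M (\<lambda>i. value_in (nth (I \<alpha> (q i))) (K i)) \<phi>" for q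
        using K2 by (intro sat_cong) blast
      ultimately show "sat M (\<lambda>i. value_in (nth (I \<alpha> (pos i))) (K i)) \<phi> =
          sat M (\<lambda>i. value_in (nth (I \<alpha> (pos' i))) (K i)) \<phi>" by blast
    qed
    then show "indiscernible L M (A \<union> (\<Union>\<beta>\<in>J - {\<alpha>}. seq_elems (I \<beta>))) (I \<alpha>)"
      by (simp add: B_def)
  qed
qed


lemma same_EM_type_transfer:
  assumes EM: "same_EM_type L M A J l I G" and P: "definable L M V A P"
    and V: "\<And>v. v \<in> V \<Longrightarrow> j v \<in> J" "\<And>v. v \<in> V \<Longrightarrow> t v < l (j v)"
    and ord: "\<And>i. same_order {v \<in> V. j v = i} p q"
  shows "P (\<lambda>v. I (j v) (p v) ! t v) = P (\<lambda>v. G (j v) (q v) ! t v)"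
proof -
  obtain \<phi> \<sigma> where \<phi>: "wf_fm L \<phi>" "\<sigma> ` fv \<phi> \<subseteq> V <+> A" "P = (\<lambda>e. sat M (\<lambda>i. value_in e (\<sigma> i)) \<phi>)"
    using P unfolding definable_def by blast
  define K where "K i = map_sum (\<lambda>v. (j v, t v)) id (\<sigma> i)" for i
  define pos where "pos i = case_sum p undefined (\<sigma> i)" for i
  define pos' where "pos' i = case_sum q undefined (\<sigma> i)" for i
  have \<sigma>: "(\<exists>v\<in>V. \<sigma> i = Inl v) \<or> (\<exists>c\<in>A. \<sigma> i = Inr c)" if "i \<in> fv \<phi>" for i
    using that \<phi>(2) by auto
  have "K i \<in> Sigma J (\<lambda>j. {..<l j}) <+> A" if "i \<in> fv \<phi>" for i
    using \<sigma>[OF that] V by (auto simp: K_def)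
  moreover have "same_order {i \<in> fv \<phi>. \<exists>s. K i = Inl (k, s)} pos pos'" for k
    unfolding same_order_def
  proof (intro ballI)
    fix x y assume "x \<in> {i \<in> fv \<phi>. \<exists>s. K i = Inl (k, s)}" "y \<in> {i \<in> fv \<phi>. \<exists>s. K i = Inl (k, s)}"
    then obtain v w where "v \<in> V" "w \<in> V" "\<sigma> x = Inl v" "\<sigma> y = Inl w" "j v = k" "j w = k"
      using \<sigma>[of x] \<sigma>[of y] by (auto simp: K_def)
    then show "pos x < pos y \<longleftrightarrow> pos' x < pos' y"
      using ord[of k] by (simp add: same_order_def pos_def pos'_def)
  qed
  ultimately have "sat M (\<lambda>i. value_in (\<lambda>(j, t). I j (pos i) ! t) (K i)) \<phi> =
      sat M (\<lambda>i. value_in (\<lambda>(j, t). G j (pos' i) ! t) (K i)) \<phi>"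
    using EM \<phi>(1) unfolding same_EM_type_def by blast
  moreover have "(\<lambda>i. value_in (\<lambda>(j, t). I j (pos i) ! t) (K i)) =
      (\<lambda>i. value_in (\<lambda>v. I (j v) (p v) ! t v) (\<sigma> i))"
    by (auto simp: fun_eq_iff K_def pos_def value_in_def split: sum.splits)
  moreover have "(\<lambda>i. value_in (\<lambda>(j, t). G j (pos' i) ! t) (K i)) =
      (\<lambda>i. value_in (\<lambda>v. G (j v) (q v) ! t v) (\<sigma> i))"
    by (auto simp: fun_eq_iff K_def pos'_def value_in_def split: sum.splits)
  ultimately show ?thesis unfolding \<phi>(3) by simp
qed

context monster
begin

text \<open>Finitely many positions of the new index order embed into the natural numbers, so the
  conditions on \<open>G\<close> are finitely satisfiable in \<open>I\<close> and compactness applies.\<close>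

lemma stretch_indiscernibles:
  fixes I :: "'j::countable \<Rightarrow> nat \<Rightarrow> 'a list"
  assumes A: "small \<kappa> M A" and I: "\<And>j m. j \<in> J \<Longrightarrow> I j m \<in> tuples M (l j)"
    and EM: "same_EM_type L M A J l I I"
  obtains G :: "'j \<Rightarrow> 'q::{countable, linorder} \<Rightarrow> 'a list"
  where "\<And>j q. j \<in> J \<Longrightarrow> G j q \<in> tuples M (l j)"
    "same_EM_type L M A J l I G" "same_EM_type L M A J l G G"
proof -
  define matching where "matching \<phi> K pos pos' \<longleftrightarrow> wf_fm L \<phi> \<and>
      K ` fv \<phi> \<subseteq> Sigma J (\<lambda>j. {..<l j}) <+> A \<and>
      (\<forall>j. same_order {i \<in> fv \<phi>. \<exists>t. K i = Inl (j, t)} pos pos') \<and>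
      sat M (\<lambda>i. value_in (\<lambda>(j, t). I j (pos i) ! t) (K i)) \<phi>"
    for \<phi> and K :: "nat \<Rightarrow> 'j \<times> nat + 'a" and pos :: "nat \<Rightarrow> nat" and pos' :: "nat \<Rightarrow> 'q"
  define pred where "pred \<phi> K pos' e \<longleftrightarrow>
      sat M (\<lambda>i. value_in (\<lambda>(j, t). e (j, pos' i, t)) (K i)) \<phi>"
    for \<phi> and K :: "nat \<Rightarrow> 'j \<times> nat + 'a" and pos' :: "nat \<Rightarrow> 'q" and e
  define \<Sigma> where "\<Sigma> = {P. \<exists>\<phi> K pos pos'. matching \<phi> K pos pos' \<and> P = pred \<phi> K pos'}"
  obtain u where u: "u \<in> univ M" using univ_ne by blast
  define spread where "spread h = (\<lambda>(j, q, t). if j \<in> J \<and> t < l j then I j (h q) ! t else u)"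
    for h :: "'q \<Rightarrow> nat"
  have "\<exists>e. range e \<subseteq> univ M \<and> (\<forall>P\<in>\<Sigma>. P e)"
  proof (rule compactness[OF A])
    fix P assume "P \<in> \<Sigma>"
    then obtain \<phi> K pos pos' where m: "matching \<phi> K pos pos'" and P: "P = pred \<phi> K pos'"
      unfolding \<Sigma>_def by blast
    define \<sigma> where "\<sigma> i = map_sum (\<lambda>(j, t). (j, pos' i, t)) id (K i)" for i
    have "\<sigma> i \<in> UNIV <+> A" if "i \<in> fv \<phi>" for i
      using that m by (cases "K i") (force simp: \<sigma>_def matching_def image_subset_iff)+
    moreover have "value_in (\<lambda>(j, t). e (j, pos' i, t)) (K i) = value_in e (\<sigma> i)" for e i
      by (cases "K i") (auto simp: \<sigma>_def split: prod.splits)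
    ultimately show "definable L M UNIV A P"
      using m by (intro definableI[of L \<phi> \<sigma>]) (auto simp: P pred_def matching_def)
  next
    fix \<Sigma>0 assume \<Sigma>0: "finite \<Sigma>0" "\<Sigma>0 \<subseteq> \<Sigma>"
    have "\<exists>Q. finite Q \<and> (\<forall>h. same_order Q h (\<lambda>q. q) \<longrightarrow> P (spread h))" if P: "P \<in> \<Sigma>" for P
    proof -
      obtain \<phi> K pos pos' where m: "matching \<phi> K pos pos'" and P: "P = pred \<phi> K pos'"
        using P unfolding \<Sigma>_def by blast
      have "P (spread h)" if h: "same_order (pos' ` fv \<phi>) h (\<lambda>q. q)" for h
      proof -
        have "same_order (fv \<phi>) (\<lambda>i. h (pos' i)) pos'"
          using h by (rule same_order_comp)
        then have "same_order {i \<in> fv \<phi>. \<exists>t. K i = Inl (j, t)} pos (\<lambda>i. h (pos' i))" for j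
          using m same_order_trans same_order_sym same_order_subset
          unfolding matching_def by (metis (no_types, lifting) mem_Collect_eq subsetI)
        then have "sat M (\<lambda>i. value_in (\<lambda>(j, t). I j (h (pos' i)) ! t) (K i)) \<phi>"
          using EM m unfolding same_EM_type_def matching_def by blast
        moreover have "value_in (\<lambda>(j, t). I j (h (pos' i)) ! t) (K i) =
            value_in (\<lambda>(j, t). spread h (j, pos' i, t)) (K i)" if "i \<in> fv \<phi>" for i
          using m that by (cases "K i") (auto simp: matching_def spread_def image_subset_iff)
        ultimately show ?thesis
          unfolding P pred_def by (simp cong: sat_cong)
      qed
      then show ?thesis using finite_fv[of \<phi>] by blast
    qed
    then obtain Q where Q: "\<And>P. P \<in> \<Sigma> \<Longrightarrow> finite (Q P)"
        "\<And>P h. P \<in> \<Sigma> \<Longrightarrow> same_order (Q P) h (\<lambda>q. q) \<Longrightarrow> P (spread h)"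
      by metis
    define Q0 where "Q0 = \<Union>(Q ` \<Sigma>0)"
    have "finite Q0" unfolding Q0_def using \<Sigma>0 Q(1) by auto
    define h where "h q = card {x \<in> Q0. x < q}" for q
    have h: "same_order Q0 h (\<lambda>q. q)"
      unfolding h_def using \<open>finite Q0\<close> by (rule same_order_rank_self)
    have "P (spread h)" if "P \<in> \<Sigma>0" for P
    proof (rule Q(2))
      show "P \<in> \<Sigma>" using that \<Sigma>0(2) by blast
      show "same_order (Q P) h (\<lambda>q. q)"
        using h by (rule same_order_subset) (use that in \<open>auto simp: Q0_def\<close>)
    qed
    moreover have "range (spread h) \<subseteq> univ M"
    proof -
      have "I j m ! t \<in> univ M" if "j \<in> J" "t < l j" for j m t
        using I[OF that(1), of m] that(2) by (auto simp: tuples_def)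
      then show ?thesis using u by (auto simp: spread_def)
    qed
    ultimately show "\<exists>e. range e \<subseteq> univ M \<and> (\<forall>P\<in>\<Sigma>0. P e)" by blast
  qed
  then obtain e where e: "range e \<subseteq> univ M" "\<And>P. P \<in> \<Sigma> \<Longrightarrow> P e" by blast
  define G where "G j q = map (\<lambda>t. e (j, q, t)) [0..<l j]" for j q
  have Gt: "G j q \<in> tuples M (l j)" for j q
    using e(1) by (auto simp: G_def tuples_def)
  have imp: "sat M (\<lambda>i. value_in (\<lambda>(j, t). G j (pos' i) ! t) (K i)) \<phi>"
    if m: "matching \<phi> K pos pos'" for \<phi> K pos pos'
  proof -
    have "pred \<phi> K pos' \<in> \<Sigma>" using m unfolding \<Sigma>_def by blast
    then have "pred \<phi> K pos' e" by (rule e(2))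
    moreover have "value_in (\<lambda>(j, t). G j (pos' i) ! t) (K i) =
        value_in (\<lambda>(j, t). e (j, pos' i, t)) (K i)" if "i \<in> fv \<phi>" for i
      using m that by (cases "K i") (auto simp: matching_def G_def image_subset_iff)
    ultimately show ?thesis unfolding pred_def by (simp cong: sat_cong)
  qed
  have IG: "same_EM_type L M A J l I G"
    unfolding same_EM_type_def
  proof (intro allI impI)
    fix \<phi> K and pos :: "nat \<Rightarrow> nat" and pos' :: "nat \<Rightarrow> 'q"
    assume "wf_fm L \<phi>" "K ` fv \<phi> \<subseteq> Sigma J (\<lambda>j. {..<l j}) <+> A"
      "\<forall>j. same_order {i \<in> fv \<phi>. \<exists>t. K i = Inl (j, t)} pos pos'"
    then show "sat M (\<lambda>i. value_in (\<lambda>(j, t). I j (pos i) ! t) (K i)) \<phi> =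
        sat M (\<lambda>i. value_in (\<lambda>(j, t). G j (pos' i) ! t) (K i)) \<phi>"
      using imp[of \<phi> K pos pos'] imp[of "Neg \<phi>" K pos pos'] by (auto simp: matching_def)
  qed
  have GG: "same_EM_type L M A J l G G"
    unfolding same_EM_type_def
  proof (intro allI impI)
    fix \<phi> K and pos pos' :: "nat \<Rightarrow> 'q"
    assume \<phi>: "wf_fm L \<phi>" "K ` fv \<phi> \<subseteq> Sigma J (\<lambda>j. {..<l j}) <+> A"
      "\<forall>j. same_order {i \<in> fv \<phi>. \<exists>t. K i = Inl (j, t)} pos pos'"
    define h where "h q = card {x \<in> pos ` fv \<phi>. x < q}" for q
    have "same_order (pos ` fv \<phi>) h (\<lambda>q. q)"
      unfolding h_def by (rule same_order_rank_self) (simp add: finite_fv)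
    then have "same_order (fv \<phi>) (\<lambda>i. h (pos i)) pos" by (rule same_order_comp)
    then have 1: "same_order {i \<in> fv \<phi>. \<exists>t. K i = Inl (j, t)} (\<lambda>i. h (pos i)) pos" for j
      by (rule same_order_subset) auto
    then have 2: "same_order {i \<in> fv \<phi>. \<exists>t. K i = Inl (j, t)} (\<lambda>i. h (pos i)) pos'" for j
      using \<phi>(3) same_order_trans by blast
    from 1 2 show "sat M (\<lambda>i. value_in (\<lambda>(j, t). G j (pos i) ! t) (K i)) \<phi> =
        sat M (\<lambda>i. value_in (\<lambda>(j, t). G j (pos' i) ! t) (K i)) \<phi>"
      using IG[unfolded same_EM_type_def, rule_format, of \<phi> K "\<lambda>i. h (pos i)" pos]
        IG[unfolded same_EM_type_def, rule_format, of \<phi> K "\<lambda>i. h (pos i)" pos'] \<phi>(1,2)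
      by blast
  qed
  from that[OF Gt IG GG] show thesis .
qed

end


section \<open>Elementary properties of dp-rank\<close>

lemma indiscernible_mono:
  assumes "indiscernible L M B I" "A \<subseteq> B"
  shows "indiscernible L M A I"
proof -
  have "tp L M u A = tp L M u B \<inter> formulas L A (length u)" for u
    using assms(2) by (auto simp: tp_def formulas_def)
  moreover have "length (concat (map I is)) = length (concat (map I js))"
    if "length is = length js" for "is" js
  proof -
    obtain l where "\<And>i. length (I i) = l"
      using assms(1) by (auto simp: indiscernible_def sequence_def tuples_def)
    then show ?thesis using length_concat_map[of I l] that by simp
  qed
  ultimately show ?thesis
    using assms(1) unfolding indiscernible_def by metis
qed

lemma mutually_indiscernible_mono:
  assumes "mutually_indiscernible L M A J I" "J' \<subseteq> J"
  shows "mutually_indiscernible L M A J' I"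
  using assms unfolding mutually_indiscernible_def
  by (meson Diff_mono SUP_subset_mono Un_mono indiscernible_mono order_refl subsetD)

text \<open>Parameters that help to break a sequence can be appended to each of its members.\<close>

lemma absorb_parameters:
  assumes I: "\<And>m. I m \<in> tuples M l" and "B \<subseteq> univ M" and nind: "\<not> indiscernible L M (B \<union> C) I"
  obtains w where "set w \<subseteq> B" "\<not> indiscernible L M C (\<lambda>m. I m @ w)"
proof -
  obtain \<phi> K pos pos' where \<phi>: "wf_fm L \<phi>" "K ` fv \<phi> \<subseteq> {..<l} <+> (B \<union> C)"
      "same_order {i \<in> fv \<phi>. isl (K i)} pos pos'"
      "sat M (\<lambda>i. value_in (nth (I (pos i))) (K i)) \<phi> \<noteq>
       sat M (\<lambda>i. value_in (nth (I (pos' i))) (K i)) \<phi>"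
    using nind unfolding indiscernible_iff[of I M l L "B \<union> C", OF I] by blast
  define X where "X = Inr -` (K ` fv \<phi>) \<inter> B"
  have "finite X"
    unfolding X_def by (intro finite_Int disjI1 finite_vimageI finite_imageI finite_fv) simp
  then obtain w where w: "set w = X" using finite_list by blast
  then have "\<exists>s<length w. w ! s = x" if "x \<in> X" for x
    using that unfolding w[symmetric] by (auto simp: in_set_conv_nth)
  then obtain idx where idx: "\<And>x. x \<in> X \<Longrightarrow> idx x < length w" "\<And>x. x \<in> X \<Longrightarrow> w ! idx x = x"
    by metis
  have wu: "set w \<subseteq> B" using w by (simp add: X_def)
  define N where "N = Suc (Max (insert 0 (pos ` fv \<phi> \<union> pos' ` fv \<phi>)))"
  have N: "pos i < N" "pos' i < N" if "i \<in> fv \<phi>" for i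
    using that finite_fv[of \<phi>] by (auto simp: N_def less_Suc_eq_le intro!: Max_ge)
  define K' where "K' i = case_sum Inl (\<lambda>c. if c \<in> X then Inl (l + idx c) else Inr c) (K i)" for i
  \<comment> \<open>The appended coordinates are read at the same position on both sides, beyond all others.\<close>
  define late where "late p i = case_sum (\<lambda>_. p i) (\<lambda>_. N) (K i)" for p :: "nat \<Rightarrow> nat" and i
  have len: "length (I m) = l" for m using I by (simp add: tuples_def)
  have K': "K' i \<in> {..<l + length w} <+> C \<and>
      value_in (nth (I (late p i) @ w)) (K' i) = value_in (nth (I (p i))) (K i)"
    if "i \<in> fv \<phi>" for i p
  proof (cases "K i")
    case (Inl t)
    then have "t < l" using that \<phi>(2) by (auto simp: image_subset_iff)
    then show ?thesis using Inl by (auto simp: K'_def late_def nth_append len)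
  next
    case (Inr c)
    then have "c \<in> B \<union> C" "c \<in> B \<Longrightarrow> c \<in> X"
      using that \<phi>(2) by (force simp: image_subset_iff X_def)+
    then show ?thesis using Inr idx by (auto simp: K'_def late_def nth_append len)
  qed
  have "same_order {i \<in> fv \<phi>. isl (K' i)} (late pos) (late pos')"
    using \<phi>(3) N by (fastforce simp: same_order_def late_def split: sum.splits)
  moreover have "sat M (\<lambda>i. value_in (nth (I (late p i) @ w)) (K' i)) \<phi> =
      sat M (\<lambda>i. value_in (nth (I (p i))) (K i)) \<phi>" for p
    using K' by (intro sat_cong) blast
  moreover have "K' ` fv \<phi> \<subseteq> {..<l + length w} <+> C"
    using K' by blast
  moreover have "I m @ w \<in> tuples M (l + length w)" for m
    using I[of m] wu assms(2) by (auto simp: tuples_def)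
  ultimately have "\<not> indiscernible L M C (\<lambda>m. I m @ w)"
    using \<phi>(1,4) indiscernible_iff[of "\<lambda>m. I m @ w" M "l + length w" L C] by blast
  with wu show thesis by (rule that)
qed

lemma mutually_indiscernible_append:
  fixes I :: "'j \<Rightarrow> 'p::linorder \<Rightarrow> 'a list"
  assumes "same_EM_type L M B J l I I" "A \<subseteq> B" "\<And>j. j \<in> J \<Longrightarrow> set (w j) \<subseteq> B"
    and len: "\<And>j m. j \<in> J \<Longrightarrow> length (I j m) = l j"
  shows "same_EM_type L M A J (\<lambda>j. l j + length (w j)) (\<lambda>j m. I j m @ w j) (\<lambda>j m. I j m @ w j)"
  unfolding same_EM_type_def
proof (intro allI impI)
  fix \<phi> K and pos pos' :: "nat \<Rightarrow> 'p"
  assume \<phi>: "wf_fm L \<phi>" "K ` fv \<phi> \<subseteq> Sigma J (\<lambda>j. {..<l j + length (w j)}) <+> A"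
    "\<forall>j. same_order {i \<in> fv \<phi>. \<exists>t. K i = Inl (j, t)} pos pos'"
  define K' where "K' i = (case K i of Inl (j, t) \<Rightarrow> if t < l j then Inl (j, t) else Inr (w j ! (t - l j))
      | Inr c \<Rightarrow> Inr c)" for i
  have K': "K' i \<in> Sigma J (\<lambda>j. {..<l j}) <+> B \<and>
      value_in (\<lambda>(j, t). I j (p i) ! t) (K' i) = value_in (\<lambda>(j, t). (I j (p i) @ w j) ! t) (K i)"
    if "i \<in> fv \<phi>" for i p
  proof (cases "K i")
    case (Inl x)
    obtain j t where x: "x = (j, t)" by (cases x)
    then have jt: "j \<in> J" "t < l j + length (w j)"
      using that \<phi>(2) Inl by (auto simp: image_subset_iff)
    then show ?thesis
      using Inl x assms(3)[OF jt(1)] nth_mem[of "t - l j" "w j"] len[OF jt(1)]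
      by (auto simp: K'_def nth_append)
  next
    case (Inr c)
    then show ?thesis
      using that \<phi>(2) assms(2) by (force simp: K'_def image_subset_iff)
  qed
  have "\<exists>t. K i = Inl (j, t)" if "K' i = Inl (j, t)" for i j t
    using that by (cases "K i") (auto simp: K'_def split: prod.splits if_splits)
  then have "same_order {i \<in> fv \<phi>. \<exists>t. K' i = Inl (j, t)} pos pos'" for j
    using \<phi>(3)[rule_format, of j] by (elim same_order_subset) blast
  moreover have "K' ` fv \<phi> \<subseteq> Sigma J (\<lambda>j. {..<l j}) <+> B" using K' by blast
  ultimately have "sat M (\<lambda>i. value_in (\<lambda>(j, t). I j (pos i) ! t) (K' i)) \<phi> =
      sat M (\<lambda>i. value_in (\<lambda>(j, t). I j (pos' i) ! t) (K' i)) \<phi>"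
    using assms(1) \<phi>(1) unfolding same_EM_type_def by blast
  moreover have "sat M (\<lambda>i. value_in (\<lambda>(j, t). I j (p i) ! t) (K' i)) \<phi> =
      sat M (\<lambda>i. value_in (\<lambda>(j, t). (I j (p i) @ w j) ! t) (K i)) \<phi>" for p
    using K' by (intro sat_cong) blast
  ultimately show "sat M (\<lambda>i. value_in (\<lambda>(j, t). (I j (pos i) @ w j) ! t) (K i)) \<phi> =
      sat M (\<lambda>i. value_in (\<lambda>(j, t). (I j (pos' i) @ w j) ! t) (K i)) \<phi>" by blast
qed

lemma mutually_indiscernible_lengths:
  assumes "mutually_indiscernible L M A J I"
  obtains l where "\<And>j m. j \<in> J \<Longrightarrow> I j m \<in> tuples M (l j)"
  using assms unfolding mutually_indiscernible_def indiscernible_def sequence_def by metis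

text \<open>If a larger parameter set is needed to break the sequences, the finitely many parameters
  involved are appended to their members. Hence enlarging the parameter set does not raise dp-rank,
  and finite dp-rank over the empty set carries over to every set.\<close>

lemma dpr_less_mono:
  assumes less: "dpr_less L M A m \<Sigma> J" and "A \<subseteq> B" "B \<subseteq> univ M"
    and real: "realizations M m \<Sigma>' \<subseteq> realizations M m \<Sigma>"
  shows "dpr_less L M B m \<Sigma>' J"
  unfolding dpr_less_def
proof (intro allI impI ballI)
  fix I b assume mut: "mutually_indiscernible L M B J I" and b: "b \<in> realizations M m \<Sigma>'"
  obtain l where I: "\<And>j m. j \<in> J \<Longrightarrow> I j m \<in> tuples M (l j)"
    using mutually_indiscernible_lengths[OF mut] by blast
  show "\<exists>\<beta>\<in>J. indiscernible L M (B \<union> set b) (I \<beta>)"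
  proof (rule ccontr)
    assume "\<not> ?thesis"
    then have "\<exists>w. set w \<subseteq> B \<and> \<not> indiscernible L M (set b) (\<lambda>m. I \<beta> m @ w)" if "\<beta> \<in> J" for \<beta>
      using that absorb_parameters[of "I \<beta>" M "l \<beta>" B L "set b", OF I] assms(3) by metis
    then obtain w where w: "\<And>j. j \<in> J \<Longrightarrow> set (w j) \<subseteq> B"
        "\<And>j. j \<in> J \<Longrightarrow> \<not> indiscernible L M (set b) (\<lambda>m. I j m @ w j)"
      by metis
    have "same_EM_type L M B J l I I"
      using mut mutually_indiscernible_iff[of J I M l] I by blast
    then have "same_EM_type L M A J (\<lambda>j. l j + length (w j)) (\<lambda>j m. I j m @ w j) (\<lambda>j m. I j m @ w j)"
    proof (rule mutually_indiscernible_append[OF _ assms(2)])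
      show "set (w j) \<subseteq> B" if "j \<in> J" for j using w(1)[OF that] .
      show "length (I j m) = l j" if "j \<in> J" for j m using I[OF that] by (simp add: tuples_def)
    qed
    moreover have "I j m @ w j \<in> tuples M (l j + length (w j))" if "j \<in> J" for j m
      using I[OF that, of m] w(1)[OF that] assms(3) by (auto simp: tuples_def)
    ultimately have "mutually_indiscernible L M A J (\<lambda>j m. I j m @ w j)"
      by (subst mutually_indiscernible_iff) auto
    then obtain \<beta> where "\<beta> \<in> J" "indiscernible L M (A \<union> set b) (\<lambda>m. I \<beta> m @ w \<beta>)"
      using less b real unfolding dpr_less_def by blast
    then show False using w(2) indiscernible_mono by blast
  qed
qed

lemma dpr_less_index_mono:
  assumes "dpr_less L M A m \<Sigma> J'" "J' \<subseteq> J"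
  shows "dpr_less L M A m \<Sigma> J"
  using assms mutually_indiscernible_mono unfolding dpr_less_def by (metis subsetD)

lemma self_realizes_tp: "set a \<subseteq> univ M \<Longrightarrow> a \<in> realizations M (length a) (tp L M a A)"
  by (simp add: realizations_tp_iff tuples_def)

lemma enat_le_dpr: "\<not> dpr_less L M A (length a) (tp L M a A) {..<n} \<Longrightarrow> enat n \<le> dpr L M a A"
  unfolding dpr_def by (auto intro: Sup_upper)

lemma dpr_le_enat:
  assumes "dpr_less L M A (length a) (tp L M a A) {..<Suc n}"
  shows "dpr L M a A \<le> enat n"
  unfolding dpr_def
proof (rule Sup_least)
  fix x assume "x \<in> {enat n |n. \<not> dpr_less L M A (length a) (tp L M a A) {..<n}}"
  then obtain k where k: "x = enat k" "\<not> dpr_less L M A (length a) (tp L M a A) {..<k}" by blast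
  then have "\<not> Suc n \<le> k" using dpr_less_index_mono[OF assms, of "{..<k}"] by auto
  then show "x \<le> enat n" using k by simp
qed

lemma dpr_attained:
  assumes a: "set a \<subseteq> univ M" and N: "dpr L M a A = enat N"
  shows "\<not> dpr_less L M A (length a) (tp L M a A) {..<N}"
proof (cases N)
  case 0
  then show ?thesis using self_realizes_tp[OF a]
    by (auto simp: dpr_less_def mutually_indiscernible_def)
next
  case (Suc k)
  then have "\<not> dpr L M a A \<le> enat k" using N by simp
  then obtain n where n: "\<not> dpr_less L M A (length a) (tp L M a A) {..<n}" "\<not> n \<le> k"
    unfolding dpr_def Sup_le_iff by auto
  then have "{..<N} \<subseteq> {..<n}" using Suc by auto
  then show ?thesis using n(1) dpr_less_index_mono by blast
qed

lemma dpr_cong: "tp L M a A = tp L M a' A \<Longrightarrow> length a = length a' \<Longrightarrow> dpr L M a A = dpr L M a' A"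
  by (simp add: dpr_def)

lemma dpr_mono:
  assumes "A \<subseteq> B" "B \<subseteq> univ M"
  shows "dpr L M a B \<le> dpr L M a A"
proof -
  have "tp L M a A \<subseteq> tp L M a B" using assms(1) by (auto simp: tp_def formulas_def)
  then have "realizations M (length a) (tp L M a B) \<subseteq> realizations M (length a) (tp L M a A)"
    by (auto simp: realizations_def)
  then show ?thesis
    unfolding dpr_def using dpr_less_mono[OF _ assms] by (intro Sup_subset_mono) blast
qed

text \<open>Permuting a tuple keeps its set of entries, which is all that matters for breaking sequences.\<close>

lemma dpr_append_commute_le: "dpr L M (u @ v) A \<le> dpr L M (v @ u) A"
proof -
  have "\<not> dpr_less L M A (length (v @ u)) (tp L M (v @ u) A) {..<n}"
    if nless: "\<not> dpr_less L M A (length (u @ v)) (tp L M (u @ v) A) {..<n}" for n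
  proof -
    obtain I c where I: "mutually_indiscernible L M A {..<n} I"
        "\<And>\<beta>. \<beta> < n \<Longrightarrow> \<not> indiscernible L M (A \<union> set c) (I \<beta>)"
      and c: "c \<in> realizations M (length (u @ v)) (tp L M (u @ v) A)"
      using nless unfolding dpr_less_def by auto
    then have ct: "c \<in> tuples M (length (u @ v))" "tp L M c A = tp L M (u @ v) A"
      by (simp_all only: realizations_tp_iff)
    define c' where "c' = drop (length u) c @ take (length u) c"
    have len: "length c = length u + length v" using ct(1) by (simp add: tuples_def)
    have sc: "set c' = set c" by (metis Un_commute append_take_drop_id c'_def set_append)
    have "tp L M c' A = tp L M (v @ u) A"
    proof (subst tp_eq_iff)
      show "length c' = length (v @ u)" using len by (simp add: c'_def)
      show "\<forall>P. definable L M {..<length (v @ u)} A P \<longrightarrow> P (nth c') = P (nth (v @ u))"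
      proof (intro allI impI)
        fix P assume P: "definable L M {..<length (v @ u)} A P"
        define f where "f i = (if i < length v then length u + i else i - length v)" for i
        have "definable L M {..<length (u @ v)} A (\<lambda>e. P (\<lambda>i. e (f i)))"
          using P by (rule definable_reindex) (auto simp: f_def)
        then have "P (\<lambda>i. c ! f i) = P (\<lambda>i. (u @ v) ! f i)"
          using tp_eq_iff[of c "u @ v" L M A, THEN iffD1, OF _ ct(2), rule_format] len by simp
        moreover have "P (\<lambda>i. c ! f i) = P (nth c')"
          by (rule definable_cong[OF P]) (auto simp: f_def c'_def nth_append len)
        moreover have "P (\<lambda>i. (u @ v) ! f i) = P (nth (v @ u))"
          by (rule definable_cong[OF P]) (auto simp: f_def nth_append)
        ultimately show "P (nth c') = P (nth (v @ u))" by simp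
      qed
    qed
    moreover have "c' \<in> tuples M (length (v @ u))"
      using ct(1) len sc by (auto simp: tuples_def c'_def)
    ultimately have "c' \<in> realizations M (length (v @ u)) (tp L M (v @ u) A)"
      by (simp only: realizations_tp_iff)
    then show ?thesis using I unfolding dpr_less_def sc[symmetric] by blast
  qed
  then show ?thesis unfolding dpr_def by (intro Sup_subset_mono) blast
qed

lemma dpr_append_commute: "dpr L M (u @ v) A = dpr L M (v @ u) A"
  by (intro antisym dpr_append_commute_le)


section \<open>Consequences of additivity\<close>

context monster
begin

lemma small_Un_set: "small \<kappa> M A \<Longrightarrow> set c \<subseteq> univ M \<Longrightarrow> small \<kappa> M (A \<union> set c)"
  by (rule small_Un_countable) (auto intro: countable_finite)

lemma dpr_Nil: "dpr L M [] A = 0"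
proof -
  have "dpr_less L M A 0 \<Sigma> {..<Suc 0}" for \<Sigma>
    unfolding dpr_less_def
  proof (intro allI impI ballI)
    fix I b assume mut: "mutually_indiscernible L M A {..<Suc 0} I" and "b \<in> realizations M 0 \<Sigma>"
    then have "b = []" by (simp add: realizations_def tuples_def)
    moreover have "indiscernible L M A (I 0)"
      using mut indiscernible_mono by (fastforce simp: mutually_indiscernible_def)
    ultimately show "\<exists>\<beta>\<in>{..<Suc 0}. indiscernible L M (A \<union> set b) (I \<beta>)" by auto
  qed
  then have "dpr L M [] A \<le> enat 0" by (intro dpr_le_enat) simp
  then show ?thesis by (simp add: zero_enat_def[symmetric])
qed

lemma dpr_finite:
  assumes add: "dp_rank_additive L \<kappa> M" and fin: "dp_rank_finite L M"
  shows "set a \<subseteq> univ M \<Longrightarrow> small \<kappa> M A \<Longrightarrow> dpr L M a A \<noteq> \<infinity>"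
proof (induction a)
  case Nil
  then show ?case by (simp add: dpr_Nil)
next
  case (Cons x xs)
  have B: "small \<kappa> M (A \<union> set xs)"
    using Cons.prems by (intro small_Un_set) auto
  obtain n :: nat where n: "dpr_less L M {} 1 {(Eq (Var 0) (Var 0), [])} {..<n}"
    using fin unfolding dp_rank_finite_def by blast
  have "dpr_less L M (A \<union> set xs) 1 (tp L M [x] (A \<union> set xs)) {..<n}"
  proof (rule dpr_less_mono[OF n])
    show "A \<union> set xs \<subseteq> univ M" using small_subset_univ[OF B] .
  qed (auto simp: realizations_def holds_def)
  then have "dpr_less L M (A \<union> set xs) (length [x]) (tp L M [x] (A \<union> set xs)) {..<Suc n}"
    by (auto elim: dpr_less_index_mono)
  then have "dpr L M [x] (A \<union> set xs) \<noteq> \<infinity>"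
    using dpr_le_enat[of L M "A \<union> set xs" "[x]" n] by (metis enat_ord_simps(5) infinity_ileE)
  moreover have "dpr L M ([x] @ xs) A = dpr L M [x] (A \<union> set xs) + dpr L M xs A"
    using add[unfolded dp_rank_additive_def, rule_format, of "[x]" xs A] Cons.prems by simp
  ultimately show ?case using Cons by (simp add: plus_eq_infty_iff_enat)
qed

lemma dpr_concat_le:
  assumes add: "dp_rank_additive L \<kappa> M" and A: "small \<kappa> M A"
    and us: "\<And>u. u \<in> set us \<Longrightarrow> set u \<subseteq> univ M" "\<And>u. u \<in> set us \<Longrightarrow> dpr L M u A \<le> enat d"
  shows "dpr L M (concat us) A \<le> enat (length us * d)"
  using us
proof (induction us)
  case Nil
  then show ?case by (simp add: dpr_Nil zero_enat_def)
next
  case (Cons u us)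
  have s: "set (concat us) \<subseteq> univ M" using Cons.prems(1) by auto
  have "dpr L M (u @ concat us) A = dpr L M u (A \<union> set (concat us)) + dpr L M (concat us) A"
    using add A s Cons.prems(1)[of u] unfolding dp_rank_additive_def by auto
  also have "\<dots> \<le> enat d + enat (length us * d)"
  proof (rule add_mono)
    have "dpr L M u (A \<union> set (concat us)) \<le> dpr L M u A"
      using small_subset_univ[OF A] s by (intro dpr_mono) auto
    then show "dpr L M u (A \<union> set (concat us)) \<le> enat d"
      using Cons.prems(2)[of u] by (auto intro: order_trans)
    show "dpr L M (concat us) A \<le> enat (length us * d)"
      using Cons by auto
  qed
  finally show ?case by simp
qed


section \<open>Realizations that break separate blocks of an indiscernible array\<close>

text \<open>One formula for each sequence shows that \<open>b\<close> breaks it. The conjunction \<open>\<psi>\<close> speaks of the entries of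
  \<open>b\<close> and of finitely many entries \<open>(j, m, t)\<close> of the sequences, and can be transferred to other tuples
  and other sequences.\<close>

lemma breaking_predicate:
  fixes I :: "nat \<Rightarrow> nat \<Rightarrow> 'a list"
  assumes I: "\<And>j m. j < N \<Longrightarrow> I j m \<in> tuples M (l j)"
    and nind: "\<And>j. j < N \<Longrightarrow> \<not> indiscernible L M (A \<union> set b) (I j)"
  obtains \<psi> where
    "definable L M ({..<length b} <+> {(j, m, t). j < N \<and> t < l j}) A \<psi>"
    "\<psi> (case_sum (nth b) (\<lambda>(j, m, t). I j m ! t))"
    "\<And>c (H :: nat \<Rightarrow> nat \<Rightarrow> 'a list) j. length c = length b \<Longrightarrow> (\<And>j m. j < N \<Longrightarrow> H j m \<in> tuples M (l j)) \<Longrightarrow>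
      \<psi> (case_sum (nth c) (\<lambda>(j, m, t). H j m ! t)) \<Longrightarrow> j < N \<Longrightarrow>
      \<not> indiscernible L M (A \<union> set c) (H j)"
proof -
  define broken where "broken j \<phi> K pos pos' \<longleftrightarrow>
      wf_fm L \<phi> \<and> K ` fv \<phi> \<subseteq> {..<l j} <+> (A \<union> set b) \<and>
      same_order {i \<in> fv \<phi>. isl (K i)} pos pos' \<and>
      sat M (\<lambda>i. value_in (nth (I j (pos i))) (K i)) \<phi> \<noteq>
      sat M (\<lambda>i. value_in (nth (I j (pos' i))) (K i)) \<phi>"
    for j \<phi> K and pos pos' :: "nat \<Rightarrow> nat"
  have "\<exists>\<phi> K pos pos'. broken j \<phi> K pos pos'" if "j < N" for j
    using nind[OF that] unfolding indiscernible_iff[of "I j" M "l j" L "A \<union> set b", OF I[OF that]]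
      broken_def by blast
  then obtain \<phi> K pos pos' where br: "\<And>j. j < N \<Longrightarrow> broken j (\<phi> j) (K j) (pos j) (pos' j)"
    by metis
  have \<phi>: "wf_fm L (\<phi> j)" "K j ` fv (\<phi> j) \<subseteq> {..<l j} <+> (A \<union> set b)"
      "same_order {i \<in> fv (\<phi> j). isl (K j i)} (pos j) (pos' j)"
      "sat M (\<lambda>i. value_in (nth (I j (pos j i))) (K j i)) (\<phi> j) \<noteq>
        sat M (\<lambda>i. value_in (nth (I j (pos' j i))) (K j i)) (\<phi> j)" if "j < N" for j
    using br[OF that] unfolding broken_def by blast+
  have "\<exists>s<length b. b ! s = x" if "x \<in> set b" for x
    using that by (auto simp: in_set_conv_nth)
  then obtain idx where idx: "\<And>x. x \<in> set b \<Longrightarrow> idx x < length b" "\<And>x. x \<in> set b \<Longrightarrow> b ! idx x = x"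
    by metis
  define \<sigma> where "\<sigma> j p i = case_sum (\<lambda>t. Inl (Inr (j, p i, t)))
      (\<lambda>x. if x \<in> A then Inr x else Inl (Inl (idx x))) (K j i)"
    for j :: nat and p :: "nat \<Rightarrow> nat" and i
  define X where "X j p e \<longleftrightarrow> sat M (\<lambda>i. value_in e (\<sigma> j p i)) (\<phi> j)" for j p and e :: "_ \<Rightarrow> 'a"
  define \<psi> where "\<psi> e \<longleftrightarrow> (\<forall>j\<in>{..<N}. X j (pos j) e \<noteq> X j (pos' j) e)" for e
  have Kcases: "(\<exists>t<l j. K j i = Inl t) \<or> (\<exists>x\<in>A \<union> set b. K j i = Inr x)"
    if "j < N" "i \<in> fv (\<phi> j)" for i j
    using \<phi>(2)[OF that(1)] that(2) by (cases "K j i") (force simp: image_subset_iff)+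
  define V :: "(nat + nat \<times> nat \<times> nat) set" where "V = {..<length b} <+> {(j, m, t). j < N \<and> t < l j}"
  have "definable L M V A (X j p)" if "j < N" for j p
  proof (rule definableI[OF \<phi>(1)[OF that]])
    have "\<sigma> j p i \<in> V <+> A" if "i \<in> fv (\<phi> j)" for i
      using Kcases[OF \<open>j < N\<close> that] idx(1) \<open>j < N\<close> by (auto simp: \<sigma>_def V_def)
    then show "\<sigma> j p ` fv (\<phi> j) \<subseteq> V <+> A" by blast
  qed (simp add: X_def)
  then have def: "definable L M V A \<psi>"
    unfolding \<psi>_def[abs_def] by (intro definable_Ball univ_ne definable_Xor) auto
  have X: "X j p (case_sum (nth c) (\<lambda>(j, m, t). H j m ! t)) =
      sat M (\<lambda>i. value_in (nth (H j (p i))) (map_sum id (\<lambda>x. if x \<in> A then x else c ! idx x) (K j i))) (\<phi> j)"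
    for j p c and H :: "nat \<Rightarrow> nat \<Rightarrow> 'a list"
    unfolding X_def by (intro sat_cong) (auto simp: \<sigma>_def split: sum.splits)
  show thesis
  proof
    show "definable L M ({..<length b} <+> {(j, m, t). j < N \<and> t < l j}) A \<psi>"
      using def by (simp add: V_def)
    have "X j p (case_sum (nth b) (\<lambda>(j, m, t). I j m ! t)) =
        sat M (\<lambda>i. value_in (nth (I j (p i))) (K j i)) (\<phi> j)" if "j < N" for j p
      unfolding X
    proof (rule sat_cong)
      fix i assume "i \<in> fv (\<phi> j)"
      then show "value_in (nth (I j (p i))) (map_sum id (\<lambda>x. if x \<in> A then x else b ! idx x) (K j i)) =
          value_in (nth (I j (p i))) (K j i)"
        using Kcases[OF that, of i] idx(2) by auto
    qed
    then show "\<psi> (case_sum (nth b) (\<lambda>(j, m, t). I j m ! t))"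
      using \<phi>(4) by (simp add: \<psi>_def)
  next
    fix c and H :: "nat \<Rightarrow> nat \<Rightarrow> 'a list" and j
    assume c: "length c = length b" and H: "\<And>j m. j < N \<Longrightarrow> H j m \<in> tuples M (l j)"
      and \<psi>: "\<psi> (case_sum (nth c) (\<lambda>(j, m, t). H j m ! t))" and j: "j < N"
    define K' where "K' i = map_sum id (\<lambda>x. if x \<in> A then x else c ! idx x) (K j i)" for i
    have "K' i \<in> {..<l j} <+> (A \<union> set c)" if "i \<in> fv (\<phi> j)" for i
      using Kcases[OF j that] idx(1) c by (auto simp: K'_def)
    then have "K' ` fv (\<phi> j) \<subseteq> {..<l j} <+> (A \<union> set c)" by blast
    moreover have "isl (K' i) = isl (K j i)" for i by (cases "K j i") (auto simp: K'_def)
    then have "same_order {i \<in> fv (\<phi> j). isl (K' i)} (pos j) (pos' j)"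
      using \<phi>(3)[OF j] by simp
    moreover have "sat M (\<lambda>i. value_in (nth (H j (pos j i))) (K' i)) (\<phi> j) \<noteq>
        sat M (\<lambda>i. value_in (nth (H j (pos' j i))) (K' i)) (\<phi> j)"
      using \<psi> j unfolding \<psi>_def X K'_def by simp
    ultimately show "\<not> indiscernible L M (A \<union> set c) (H j)"
      using \<phi>(1)[OF j] unfolding indiscernible_iff[of "H j" M "l j" L "A \<union> set c", OF H[OF j]]
      by blast
  qed
qed

text \<open>Moving positions inside one block without changing their order does not change the
  lexicographic order of all positions, so the sequences \<open>\<lambda>m. G j (i, m)\<close> for different \<open>i\<close> or \<open>j\<close> are again
  mutually indiscernible. Breaking \<open>N\<close> of them with each of \<open>k\<close> tuples gives rank \<open>k * N\<close>.\<close>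

lemma dpr_concat_ge:
  fixes G :: "nat \<Rightarrow> nat \<times> nat \<Rightarrow> 'a list"
  assumes G: "\<And>j q. j < N \<Longrightarrow> G j q \<in> tuples M (l j)"
    and EM: "same_EM_type L M A {..<N} l G G"
    and bs: "\<And>i. i < k \<Longrightarrow> set (bs i) \<subseteq> univ M"
    and breaks: "\<And>i j. i < k \<Longrightarrow> j < N \<Longrightarrow> \<not> indiscernible L M (A \<union> set (bs i)) (\<lambda>m. G j (i, m))"
  shows "enat (k * N) \<le> dpr L M (concat (map bs [0..<k])) A"
proof -
  \<comment> \<open>The number \<open>\<alpha> = i * N + j\<close> encodes the \<open>j\<close>-th sequence of the \<open>i\<close>-th block.\<close>
  define F where "F \<alpha> m = G (\<alpha> mod N) (\<alpha> div N, m)" for \<alpha> m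
  have \<alpha>: "\<alpha> mod N < N" "\<alpha> div N < k" if "\<alpha> < k * N" for \<alpha>
    using that by (auto simp: less_mult_imp_div_less intro!: mod_less_divisor gr0I)
  have "same_EM_type L M A {..<k * N} (\<lambda>\<alpha>. l (\<alpha> mod N)) F F"
    unfolding same_EM_type_def
  proof (intro allI impI)
    fix \<phi> K and pos pos' :: "nat \<Rightarrow> nat"
    assume \<phi>: "wf_fm L \<phi>" "K ` fv \<phi> \<subseteq> Sigma {..<k * N} (\<lambda>\<alpha>. {..<l (\<alpha> mod N)}) <+> A"
      "\<forall>\<alpha>. same_order {i \<in> fv \<phi>. \<exists>t. K i = Inl (\<alpha>, t)} pos pos'"
    define K' where "K' i = map_sum (\<lambda>(\<alpha>, t). (\<alpha> mod N, t)) id (K i)" for i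
    define blk where "blk p i = case_sum (\<lambda>(\<alpha>, t). (\<alpha> div N, p i)) undefined (K i)"
      for p :: "nat \<Rightarrow> nat" and i
    have K': "K' i \<in> Sigma {..<N} (\<lambda>j. {..<l j}) <+> A" if "i \<in> fv \<phi>" for i
      using that \<phi>(2) \<alpha>(1) by (cases "K i") (force simp: K'_def image_subset_iff)+
    have "same_order {i \<in> fv \<phi>. \<exists>t. K' i = Inl (j, t)} (blk pos) (blk pos')" for j
      unfolding same_order_def
    proof (intro ballI)
      fix x y assume "x \<in> {i \<in> fv \<phi>. \<exists>t. K' i = Inl (j, t)}" "y \<in> {i \<in> fv \<phi>. \<exists>t. K' i = Inl (j, t)}"
      then obtain \<alpha> t \<beta> s where xy: "x \<in> fv \<phi>" "y \<in> fv \<phi>" "K x = Inl (\<alpha>, t)" "K y = Inl (\<beta>, s)"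
          "\<alpha> mod N = j" "\<beta> mod N = j"
        by (cases "K x"; cases "K y") (auto simp: K'_def)
      show "blk pos x < blk pos y \<longleftrightarrow> blk pos' x < blk pos' y"
      proof (cases "\<alpha> div N = \<beta> div N")
        case True
        then have "\<alpha> = \<beta>" using xy(5,6) by (metis div_mult_mod_eq)
        then have "pos x < pos y \<longleftrightarrow> pos' x < pos' y"
          using \<phi>(3)[rule_format, of \<alpha>] xy by (auto simp: same_order_def)
        then show ?thesis using True xy by (simp add: blk_def less_prod_def)
      next
        case False
        then show ?thesis using xy by (auto simp: blk_def less_prod_def)
      qed
    qed
    then have "sat M (\<lambda>i. value_in (\<lambda>(j, t). G j (blk pos i) ! t) (K' i)) \<phi> =
        sat M (\<lambda>i. value_in (\<lambda>(j, t). G j (blk pos' i) ! t) (K' i)) \<phi>"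
      using EM \<phi>(1) K' unfolding same_EM_type_def by (meson image_subset_iff)
    moreover have "value_in (\<lambda>(j, t). G j (blk p i) ! t) (K' i) = value_in (\<lambda>(j, t). F j (p i) ! t) (K i)"
      for p i
      by (cases "K i") (auto simp: K'_def blk_def F_def)
    ultimately show "sat M (\<lambda>i. value_in (\<lambda>(j, t). F j (pos i) ! t) (K i)) \<phi> =
        sat M (\<lambda>i. value_in (\<lambda>(j, t). F j (pos' i) ! t) (K i)) \<phi>" by simp
  qed
  moreover have "F \<alpha> m \<in> tuples M (l (\<alpha> mod N))" if "\<alpha> \<in> {..<k * N}" for \<alpha> m
    using G \<alpha>(1) that by (auto simp: F_def)
  ultimately have mut: "mutually_indiscernible L M A {..<k * N} F"
    using mutually_indiscernible_iff[of "{..<k * N}" F M "\<lambda>\<alpha>. l (\<alpha> mod N)" L A] by blast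
  have "\<not> indiscernible L M (A \<union> set (concat (map bs [0..<k]))) (F \<beta>)" if "\<beta> < k * N" for \<beta>
  proof -
    have "\<not> indiscernible L M (A \<union> set (bs (\<beta> div N))) (F \<beta>)"
      using breaks[OF \<alpha>(2)[OF that] \<alpha>(1)[OF that]] by (simp add: F_def[abs_def])
    moreover have "A \<union> set (bs (\<beta> div N)) \<subseteq> A \<union> set (concat (map bs [0..<k]))"
      using \<alpha>(2)[OF that] by auto
    ultimately show ?thesis using indiscernible_mono by blast
  qed
  moreover have "set (concat (map bs [0..<k])) \<subseteq> univ M" using bs by fastforce
  ultimately have "\<not> dpr_less L M A (length (concat (map bs [0..<k])))
      (tp L M (concat (map bs [0..<k])) A) {..<k * N}"
    using mut self_realizes_tp unfolding dpr_less_def by (metis lessThan_iff)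
  then show ?thesis by (rule enat_le_dpr)
qed

lemma tp_map_eqI:
  assumes "\<And>P. definable L M {..<length b} A P \<Longrightarrow> P (nth b) \<Longrightarrow> P y"
  shows "tp L M (map y [0..<length b]) A = tp L M b A"
proof (subst tp_eq_iff)
  show "\<forall>P. definable L M {..<length b} A P \<longrightarrow> P (nth (map y [0..<length b])) = P (nth b)"
  proof (intro allI impI)
    fix P assume P: "definable L M {..<length b} A P"
    have "P y = P (nth b)"
      using assms[OF P] assms[OF definable_Neg[OF P]] by blast
    moreover have "P (nth (map y [0..<length b])) = P y"
      by (rule definable_cong[OF P]) auto
    ultimately show "P (nth (map y [0..<length b])) = P (nth b)" by simp
  qed
qed simp

lemma array_entries_small:
  fixes G :: "nat \<Rightarrow> 'q::countable \<Rightarrow> 'a list"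
  assumes "small \<kappa> M A" "\<And>j q. j < N \<Longrightarrow> G j q \<in> tuples M (l j)"
  shows "small \<kappa> M (A \<union> (\<Union>j<N. \<Union>q. set (G j q)))"
proof (rule small_Un_countable[OF assms(1)])
  show "countable (\<Union>j<N. \<Union>q. set (G j q))"
    by (intro countable_UN countable_finite[OF finite_set]) auto
  show "(\<Union>j<N. \<Union>q. set (G j q)) \<subseteq> univ M"
    using assms(2) by (auto simp: tuples_def)
qed


lemma tuple_padding:
  assumes "u \<in> tuples M n"
  obtains y where "range y \<subseteq> univ M" "\<And>t. t < n \<Longrightarrow> y t = u ! t"
proof -
  obtain x where "x \<in> univ M" using univ_ne by blast
  then have "range (\<lambda>t. if t < n then u ! t else x) \<subseteq> univ M"
    using assms by (auto simp: tuples_def)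
  then show thesis by (rule that) simp
qed

text \<open>Witnesses for \<open>dpr(b/A) \<ge> N\<close> are stretched to an array with infinitely many blocks. By mutual
  indiscernibility each block looks like the original sequences, and hence is broken by a copy of
  \<open>b\<close>.\<close>

lemma independent_copies:
  assumes A: "small \<kappa> M A" and N: "\<not> dpr_less L M A (length b) (tp L M b A) {..<N}"
  obtains G :: "nat \<Rightarrow> nat \<times> nat \<Rightarrow> 'a list" and l and \<psi> and bs :: "nat \<Rightarrow> 'a list" where
    "\<And>j q. j < N \<Longrightarrow> G j q \<in> tuples M (l j)"
    "same_EM_type L M A {..<N} l G G"
    "definable L M ({..<length b} <+> {(j, m, t). j < N \<and> t < l j}) A \<psi>"
    "\<And>c i j. length c = length b \<Longrightarrow> \<psi> (case_sum (nth c) (\<lambda>(j, m, t). G j (i, m) ! t)) \<Longrightarrow> j < N \<Longrightarrow>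
      \<not> indiscernible L M (A \<union> set c) (\<lambda>m. G j (i, m))"
    "\<And>i. bs i \<in> tuples M (length b)" "\<And>i. tp L M (bs i) A = tp L M b A"
    "\<And>i. \<psi> (case_sum (nth (bs i)) (\<lambda>(j, m, t). G j (i, m) ! t))"
proof -
  obtain I b' where mut: "mutually_indiscernible L M A {..<N} I"
      and nind: "\<And>j. j < N \<Longrightarrow> \<not> indiscernible L M (A \<union> set b') (I j)"
      and b': "b' \<in> realizations M (length b) (tp L M b A)"
    using N unfolding dpr_less_def by auto
  then have b't: "b' \<in> tuples M (length b)" "tp L M b' A = tp L M b A"
    by (simp_all add: realizations_tp_iff)
  then have lb: "length b' = length b" by (simp add: tuples_def)
  obtain l where I: "\<And>j m. j < N \<Longrightarrow> I j m \<in> tuples M (l j)"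
    using mutually_indiscernible_lengths[OF mut] by (metis lessThan_iff)
  have EM: "same_EM_type L M A {..<N} l I I"
    using mut mutually_indiscernible_iff[of "{..<N}" I M l L A] I by simp
  define V where "V = {..<length b} <+> {(j :: nat, m :: nat, t). j < N \<and> t < l j}"
  obtain \<psi> where \<psi>: "definable L M V A \<psi>" "\<psi> (case_sum (nth b') (\<lambda>(j, m, t). I j m ! t))"
    and breaks: "\<And>c (H :: nat \<Rightarrow> nat \<Rightarrow> 'a list) j. length c = length b \<Longrightarrow>
      (\<And>j m. j < N \<Longrightarrow> H j m \<in> tuples M (l j)) \<Longrightarrow>
      \<psi> (case_sum (nth c) (\<lambda>(j, m, t). H j m ! t)) \<Longrightarrow> j < N \<Longrightarrow>
      \<not> indiscernible L M (A \<union> set c) (H j)"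
    by (rule breaking_predicate[of N I l A b', OF I nind]) (auto simp: lb V_def)
  obtain G :: "nat \<Rightarrow> nat \<times> nat \<Rightarrow> 'a list" where G: "\<And>j q. j < N \<Longrightarrow> G j q \<in> tuples M (l j)"
    and IG: "same_EM_type L M A {..<N} l I G" and GG: "same_EM_type L M A {..<N} l G G"
    using stretch_indiscernibles[of A "{..<N}" I l, OF A _ EM] I by (metis lessThan_iff)
  have "\<exists>y. range y \<subseteq> univ M \<and> (\<forall>P. definable L M {..<length b} A P \<longrightarrow> P (nth b) \<longrightarrow> P y) \<and>
      \<psi> (case_sum y (\<lambda>(j, m, t). G j (i, m) ! t))" for i
  proof -
    define B where "B = A \<union> (\<Union>j<N. \<Union>q. set (G j q))"
    have B: "small \<kappa> M B" unfolding B_def using A G by (rule array_entries_small)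
    define \<psi>i where "\<psi>i y \<longleftrightarrow> \<psi> (case_sum y (\<lambda>(j, m, t). G j (i, m) ! t))" for y
    define \<Sigma> where "\<Sigma> = {P. definable L M {..<length b} A P \<and> P (nth b)}"
    have "\<exists>y. range y \<subseteq> univ M \<and> (\<forall>P\<in>insert \<psi>i \<Sigma>. P y)"
    proof (rule compactness[OF B])
      fix P assume "P \<in> insert \<psi>i \<Sigma>"
      moreover have "definable L M UNIV B \<psi>i"
      proof -
        define s :: "nat + nat \<times> nat \<times> nat \<Rightarrow> nat + 'a"
          where "s = case_sum Inl (\<lambda>(j, m, t). Inr (G j (i, m) ! t))"
        have "definable L M UNIV B (\<lambda>e. \<psi> (\<lambda>v. value_in e (s v)))"
        proof (rule definable_subst[OF \<psi>(1)])
          fix v assume "v \<in> V"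
          then consider t where "v = Inl t" |
              j m t where "v = Inr (j, m, t)" "j < N" "t < l j"
            by (auto simp: V_def)
          then show "s v \<in> UNIV <+> B"
          proof cases
            case 2
            then have "G j (i, m) ! t \<in> set (G j (i, m))"
              using G[of j "(i, m)"] by (simp add: tuples_def)
            then show ?thesis using 2 by (auto simp: s_def B_def)
          qed (auto simp: s_def)
        qed (simp add: B_def)
        moreover have "(\<lambda>v. value_in e (s v)) = case_sum e (\<lambda>(j, m, t). G j (i, m) ! t)" for e
          by (auto simp: fun_eq_iff s_def split: sum.splits)
        ultimately show ?thesis by (simp add: \<psi>i_def[abs_def])
      qed
      moreover have "definable L M UNIV B P" if "P \<in> \<Sigma>"
        using that by (auto simp: \<Sigma>_def B_def elim!: definable_mono)
      ultimately show "definable L M UNIV B P" by auto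
    next
      fix \<Sigma>0 assume fin: "finite \<Sigma>0" and sub: "\<Sigma>0 \<subseteq> insert \<psi>i \<Sigma>"
      define R where "R e \<longleftrightarrow> (\<forall>P\<in>\<Sigma>0 - {\<psi>i}. P (\<lambda>t. e (Inl t))) \<and> \<psi> e" for e
      define Q where "Q e \<longleftrightarrow> (\<exists>e'. (\<forall>v. v \<notin> range Inl \<longrightarrow> e' v = e v) \<and>
          e' ` range Inl \<subseteq> univ M \<and> R e')" for e
      have \<Sigma>: "definable L M {..<length b} A P" "P (nth b)" if "P \<in> \<Sigma>0 - {\<psi>i}" for P
        using that sub by (auto simp: \<Sigma>_def)
      have "definable L M V A (\<lambda>e. P (\<lambda>t. e (Inl t)))" if "P \<in> \<Sigma>0 - {\<psi>i}" for P
        using \<Sigma>(1)[OF that] by (rule definable_reindex) (auto simp: V_def)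
      then have "definable L M V A R"
        unfolding R_def[abs_def] using fin \<psi>(1) by (intro definable_And definable_Ball univ_ne) auto
      then have Q: "definable L M (V - range Inl) A Q"
        unfolding Q_def[abs_def] by (intro definable_project univ_ne)
      define jj tt mm where "jj = (\<lambda>v :: nat + nat \<times> nat \<times> nat. fst (projr v))"
        and "tt = (\<lambda>v :: nat + nat \<times> nat \<times> nat. snd (snd (projr v)))"
        and "mm = (\<lambda>v :: nat + nat \<times> nat \<times> nat. fst (snd (projr v)))"
      have "Q (\<lambda>v. I (jj v) (mm v) ! tt v) = Q (\<lambda>v. G (jj v) (i, mm v) ! tt v)"
        by (rule same_EM_type_transfer[OF IG Q])
          (auto simp: V_def jj_def tt_def same_order_def less_prod_def)
      moreover have "Q (\<lambda>v. I (jj v) (mm v) ! tt v)"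
      proof -
        obtain y where y: "range y \<subseteq> univ M" "\<And>t. t < length b \<Longrightarrow> y t = b' ! t"
          using tuple_padding[OF b't(1)] by blast
        define e' where "e' = case_sum y (\<lambda>(j, m, t). I j m ! t)"
        have "P y" if "P \<in> \<Sigma>0 - {\<psi>i}" for P
        proof -
          have "P (nth b')"
            using tp_eq_iff[OF lb, THEN iffD1, OF b't(2), rule_format, OF \<Sigma>(1)[OF that]]
              \<Sigma>(2)[OF that] by simp
          moreover have "P y = P (nth b')"
            by (rule definable_cong[OF \<Sigma>(1)[OF that]]) (simp add: y)
          ultimately show ?thesis by simp
        qed
        moreover have "\<psi> e' = \<psi> (case_sum (nth b') (\<lambda>(j, m, t). I j m ! t))"
          by (rule definable_cong[OF \<psi>(1)]) (auto simp: V_def e'_def y)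
        ultimately have "R e'" using \<psi>(2) by (auto simp: R_def e'_def)
        moreover have "e' v = I (jj v) (mm v) ! tt v" if "v \<notin> range Inl" for v
          using that by (cases v) (auto simp: e'_def jj_def mm_def tt_def)
        moreover have "e' ` range Inl \<subseteq> univ M" using y(1) by (auto simp: e'_def)
        ultimately show ?thesis unfolding Q_def by blast
      qed
      ultimately have "Q (\<lambda>v. G (jj v) (i, mm v) ! tt v)" by (rule subst)
      then obtain e' where e': "\<And>v. v \<notin> range Inl \<Longrightarrow> e' v = G (jj v) (i, mm v) ! tt v"
          "e' ` range Inl \<subseteq> univ M" "R e'"
        unfolding Q_def by blast
      define y where "y t = e' (Inl t)" for t
      have "e' (Inr (j, m, t)) = G j (i, m) ! t" for j m t
        using e'(1)[of "Inr (j, m, t)"] by (auto simp: jj_def mm_def tt_def)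
      then have "e' v = case_sum y (\<lambda>(j, m, t). G j (i, m) ! t) v" for v
        by (cases v) (auto simp: y_def)
      then have "e' = case_sum y (\<lambda>(j, m, t). G j (i, m) ! t)" by blast
      then have "\<psi>i y" using e'(3) by (simp add: R_def \<psi>i_def)
      moreover have "P y" if "P \<in> \<Sigma>0 - {\<psi>i}" for P
        using e'(3)[unfolded R_def, THEN conjunct1, rule_format, OF that] by (simp add: y_def[abs_def])
      moreover have "range y \<subseteq> univ M" using e'(2) by (auto simp: y_def)
      ultimately show "\<exists>y. range y \<subseteq> univ M \<and> (\<forall>P\<in>\<Sigma>0. P y)" by blast
    qed
    then obtain y where y: "range y \<subseteq> univ M" "\<And>P. P \<in> insert \<psi>i \<Sigma> \<Longrightarrow> P y" by blast
    show ?thesis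
    proof (intro exI[of _ y] conjI allI impI)
      show "range y \<subseteq> univ M" by (rule y(1))
      show "P y" if "definable L M {..<length b} A P" "P (nth b)" for P
      proof -
        have "P \<in> insert \<psi>i \<Sigma>" using that by (simp add: \<Sigma>_def)
        then show ?thesis by (rule y(2)[of P])
      qed
      show "\<psi> (case_sum y (\<lambda>(j, m, t). G j (i, m) ! t))"
        using y(2)[of \<psi>i] by (simp add: \<psi>i_def)
    qed
  qed
  then obtain y where y: "\<And>i. range (y i) \<subseteq> univ M"
      "\<And>i P. definable L M {..<length b} A P \<Longrightarrow> P (nth b) \<Longrightarrow> P (y i)"
      "\<And>i. \<psi> (case_sum (y i) (\<lambda>(j, m, t). G j (i, m) ! t))"
    by metis
  define bs where "bs i = map (y i) [0..<length b]" for i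
  show thesis
  proof
    show "\<And>j q. j < N \<Longrightarrow> G j q \<in> tuples M (l j)" by (rule G)
    show "same_EM_type L M A {..<N} l G G" by (rule GG)
    show "definable L M ({..<length b} <+> {(j, m, t). j < N \<and> t < l j}) A \<psi>"
      using \<psi>(1) by (simp add: V_def)
    show "\<not> indiscernible L M (A \<union> set c) (\<lambda>m. G j (i, m))"
      if "length c = length b" "\<psi> (case_sum (nth c) (\<lambda>(j, m, t). G j (i, m) ! t))" "j < N" for c i j
      using breaks[of c "\<lambda>j m. G j (i, m)" j] that G by blast
    show "bs i \<in> tuples M (length b)" for i
      using y(1)[of i] by (auto simp: bs_def tuples_def)
    show "tp L M (bs i) A = tp L M b A" for i
      unfolding bs_def using y(2) by (rule tp_map_eqI)
    have "\<psi> (case_sum (nth (bs i)) (\<lambda>(j, m, t). G j (i, m) ! t)) =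
        \<psi> (case_sum (y i) (\<lambda>(j, m, t). G j (i, m) ! t))" for i
      by (rule definable_cong[OF \<psi>(1)]) (auto simp: V_def bs_def)
    then show "\<psi> (case_sum (nth (bs i)) (\<lambda>(j, m, t). G j (i, m) ! t))" for i
      using y(3) by simp
  qed
qed


section \<open>Non-forking makes the broken blocks coexist with one realization\<close>

text \<open>If \<open>\<theta>(x, b)\<close> were satisfied along no \<open>k\<close>-element set of conjugates, then it would divide, and
  the type would fork already because of this single formula. The parameters of \<open>\<theta>\<close> in \<open>A\<close> are kept
  fixed when \<open>b\<close> moves.\<close>

lemma non_forking_consistent:
  fixes bs :: "nat \<Rightarrow> 'a list"
  assumes nf: "\<not> forks L M A (length a) (tp L M a (A \<union> set b))"
    and A: "A \<subseteq> univ M" and b: "set b \<subseteq> univ M"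
    and bs: "\<And>i. bs i \<in> tuples M (length b)" "\<And>i. tp L M (bs i) A = tp L M b A"
    and \<theta>: "definable L M {..<length (a @ b)} A \<theta>" "\<theta> (nth (a @ b))"
  shows "\<exists>S x. finite S \<and> card S = k \<and> x \<in> tuples M (length a) \<and> (\<forall>i\<in>S. \<theta> (nth (x @ bs i)))"
proof -
  obtain \<phi> c where \<phi>: "wf_fm L \<phi>" "set c \<subseteq> A" "fv \<phi> \<subseteq> {..<length (a @ b) + length c}"
      "\<And>u. length u = length (a @ b) \<Longrightarrow> sat M (\<lambda>i. (u @ c) ! i) \<phi> = \<theta> (nth u)"
    using definable_imp_formula[OF \<theta>(1)] by blast
  define p where "p = (\<phi>, b @ c)"
  have p: "p \<in> tp L M a (A \<union> set b)"
    using \<phi>(1-3) \<phi>(4)[of "a @ b"] \<theta>(2) by (auto simp: p_def tp_def formulas_def holds_def add.assoc)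
  have len: "length (bs i) = length b" for i using bs(1) by (simp add: tuples_def)
  have nd: "\<not> divides L M A (length a) p"
  proof
    assume "divides L M A (length a) p"
    moreover have "p \<in> formulas L (univ M) (length a)"
      using p A b by (auto simp: tp_def formulas_def)
    moreover have "holds M p x" if "x \<in> realizations M (length a) (tp L M a (A \<union> set b))" for x
      using that p by (simp add: realizations_def)
    ultimately have "forks L M A (length a) (tp L M a (A \<union> set b))"
      unfolding forks_def by (intro exI[of _ "{p}"]) auto
    then show False using nf by blast
  qed
  have conj: "bs i @ c \<in> realizations M (length (b @ c)) (tp L M (b @ c) A)" for i
    unfolding realizations_tp_iff
  proof
    show "bs i @ c \<in> tuples M (length (b @ c))"
      using bs(1)[of i] \<phi>(2) A by (auto simp: tuples_def)
    show "tp L M (bs i @ c) A = tp L M (b @ c) A"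
    proof (subst tp_eq_iff)
      show "\<forall>P. definable L M {..<length (b @ c)} A P \<longrightarrow> P (nth (bs i @ c)) = P (nth (b @ c))"
      proof (intro allI impI)
        fix P assume P: "definable L M {..<length (b @ c)} A P"
        define s where "s v = (if v < length b then Inl v else Inr (c ! (v - length b)))" for v
        have D: "definable L M {..<length b} A (\<lambda>e. P (\<lambda>v. value_in e (s v)))"
          using P
        proof (rule definable_subst)
          fix v assume "v \<in> {..<length (b @ c)}"
          then show "s v \<in> {..<length b} <+> A"
            using \<phi>(2) nth_mem[of "v - length b" c] by (auto simp: s_def)
        qed simp
        have "P (\<lambda>v. value_in (nth (bs i)) (s v)) = P (\<lambda>v. value_in (nth b) (s v))"
          using tp_eq_iff[OF len, THEN iffD1, OF bs(2), rule_format, OF D] .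
        moreover have "(\<lambda>v. value_in (nth u) (s v)) = nth (u @ c)" if "length u = length b" for u
          using that by (auto simp: fun_eq_iff s_def nth_append)
        ultimately show "P (nth (bs i @ c)) = P (nth (b @ c))" by (simp add: len)
      qed
    qed (simp add: len)
  qed
  have "\<not> (\<forall>S. finite S \<and> card S = k \<longrightarrow>
      realizations M (length a) {(\<phi>, bs i @ c) |i. i \<in> S} = {})"
  proof
    assume *: "\<forall>S. finite S \<and> card S = k \<longrightarrow>
      realizations M (length a) {(\<phi>, bs i @ c) |i. i \<in> S} = {}"
    have "divides L M A (length a) p"
      unfolding divides_def p_def prod.case
    proof (intro exI[of _ k] exI[of _ "\<lambda>i. bs i @ c"] conjI)
      show "\<forall>i. bs i @ c \<in> realizations M (length (b @ c)) (tp L M (b @ c) A)"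
        using conj by blast
    qed (rule *)
    with nd show False ..
  qed
  then obtain S where S: "finite S" "card S = k"
      "realizations M (length a) {(\<phi>, bs i @ c) |i. i \<in> S} \<noteq> {}"
    by blast
  then obtain x where x: "x \<in> realizations M (length a) {(\<phi>, bs i @ c) |i. i \<in> S}" by blast
  have "\<theta> (nth (x @ bs i))" if "i \<in> S" for i
  proof -
    have "length (x @ bs i) = length (a @ b)"
      using x len by (simp add: realizations_def tuples_def)
    moreover have "holds M (\<phi>, bs i @ c) x" using x that by (auto simp: realizations_def)
    ultimately show ?thesis using \<phi>(4)[of "x @ bs i"] by (simp add: holds_def)
  qed
  then show ?thesis using S x by (auto simp: realizations_def)
qed

text \<open>A finite part of what is wanted of \<open>a'\<close> and \<open>b'\<close> holds for some \<open>k\<close> of the given copies, with the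
  blocks that these copies break. Since the array is indiscernible, it also holds for some tuples
  with the first \<open>k\<close> blocks, which do not depend on the finite part, and compactness applies. The
  tuples \<open>b' i\<close> found in this way still break the blocks, but need not be among the given copies.\<close>

lemma simultaneous_realization:
  fixes G :: "nat \<Rightarrow> nat \<times> nat \<Rightarrow> 'a list" and bs :: "nat \<Rightarrow> 'a list"
  assumes A: "small \<kappa> M A"
    and G: "\<And>j q. j < N \<Longrightarrow> G j q \<in> tuples M (l j)"
    and GG: "same_EM_type L M A {..<N} l G G"
    and \<psi>: "definable L M ({..<length b} <+> {(j, m, t). j < N \<and> t < l j}) A \<psi>"
    and bs: "\<And>i. bs i \<in> tuples M (length b)"
      "\<And>i. \<psi> (case_sum (nth (bs i)) (\<lambda>(j, m, t). G j (i, m) ! t))"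
    and cons: "\<And>\<theta>. definable L M {..<length (a @ b)} A \<theta> \<Longrightarrow> \<theta> (nth (a @ b)) \<Longrightarrow>
      \<exists>S x. finite S \<and> card S = k \<and> x \<in> tuples M (length a) \<and> (\<forall>i\<in>S. \<theta> (nth (x @ bs i)))"
  obtains a' b' where "a' \<in> tuples M (length a)" "\<And>i. i < k \<Longrightarrow> b' i \<in> tuples M (length b)"
    "\<And>i. i < k \<Longrightarrow> tp L M (a' @ b' i) A = tp L M (a @ b) A"
    "\<And>i. i < k \<Longrightarrow> \<psi> (case_sum (nth (b' i)) (\<lambda>(j, m, t). G j (i, m) ! t))"
proof -
  define V where "V = {..<length b} <+> {(j :: nat, m :: nat, t). j < N \<and> t < l j}"
  have \<psi>: "definable L M V A \<psi>" using \<psi> by (simp add: V_def)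
  define B where "B = A \<union> (\<Union>j<N. \<Union>q. set (G j q))"
  have B: "small \<kappa> M B" unfolding B_def using A G by (rule array_entries_small)
  \<comment> \<open>The variables \<open>(0, t)\<close> stand for the entries of \<open>a'\<close> and \<open>(Suc i, t)\<close> for those of \<open>b' i\<close>.\<close>
  define f where "f i s = (if s < length a then (0, s) else (Suc i, s - length a))" for i s :: nat
  define tval where "tval \<theta> i e \<longleftrightarrow> \<theta> (\<lambda>s. e (f i s))"
    for \<theta> :: "(nat \<Rightarrow> 'a) \<Rightarrow> bool" and i and e :: "nat \<times> nat \<Rightarrow> 'a"
  define brk where "brk i e \<longleftrightarrow> \<psi> (case_sum (\<lambda>t. e (Suc i, t)) (\<lambda>(j, m, t). G j (i, m) ! t))"
    for i and e :: "nat \<times> nat \<Rightarrow> 'a"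
  define \<Theta> where "\<Theta> = {\<theta>. definable L M {..<length (a @ b)} A \<theta> \<and> \<theta> (nth (a @ b))}"
  define \<Sigma> where "\<Sigma> = {tval \<theta> i |\<theta> i. \<theta> \<in> \<Theta> \<and> i < k} \<union> brk ` {..<k}"
  have "\<exists>e. range e \<subseteq> univ M \<and> (\<forall>P\<in>\<Sigma>. P e)"
  proof (rule compactness[OF B])
    fix P assume "P \<in> \<Sigma>"
    then consider \<theta> i where "P = tval \<theta> i" "\<theta> \<in> \<Theta>" | i where "P = brk i"
      unfolding \<Sigma>_def by blast
    then show "definable L M UNIV B P"
    proof cases
      case 1
      then have "definable L M {..<length (a @ b)} B \<theta>"
        by (auto simp: \<Theta>_def B_def elim!: definable_mono)
      then have "definable L M UNIV B (\<lambda>e. \<theta> (\<lambda>s. e (f i s)))"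
        by (rule definable_reindex) simp
      then show ?thesis by (simp add: 1 tval_def[abs_def])
    next
      case 2
      define s :: "nat + nat \<times> nat \<times> nat \<Rightarrow> (nat \<times> nat) + 'a"
        where "s = case_sum (\<lambda>t. Inl (Suc i, t)) (\<lambda>(j, m, t). Inr (G j (i, m) ! t))"
      have "definable L M UNIV B (\<lambda>e. \<psi> (\<lambda>v. value_in e (s v)))"
      proof (rule definable_subst[OF \<psi>])
        fix v assume "v \<in> V"
        then consider t where "v = Inl t" |
            j m t where "v = Inr (j, m, t)" "j < N" "t < l j"
          by (auto simp: V_def)
        then show "s v \<in> UNIV <+> B"
        proof cases
          case 2
          then have "G j (i, m) ! t \<in> set (G j (i, m))"
            using G[of j "(i, m)"] by (simp add: tuples_def)
          then show ?thesis using 2 by (auto simp: s_def B_def)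
        qed (auto simp: s_def)
      qed (simp add: B_def)
      moreover have "(\<lambda>v. value_in e (s v)) =
          case_sum (\<lambda>t. e (Suc i, t)) (\<lambda>(j, m, t). G j (i, m) ! t)" for e
        by (auto simp: fun_eq_iff s_def split: sum.splits)
      ultimately show ?thesis by (simp add: 2 brk_def[abs_def])
    qed
  next
    fix \<Sigma>0 assume fin: "finite \<Sigma>0" and sub: "\<Sigma>0 \<subseteq> \<Sigma>"
    have "\<exists>\<theta>. \<theta> \<in> \<Theta> \<and> (\<exists>i<k. P = tval \<theta> i)" if "P \<in> \<Sigma>0 - brk ` {..<k}" for P
      using that sub unfolding \<Sigma>_def by blast
    then obtain th where th: "\<And>P. P \<in> \<Sigma>0 - brk ` {..<k} \<Longrightarrow> th P \<in> \<Theta>"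
        "\<And>P. P \<in> \<Sigma>0 - brk ` {..<k} \<Longrightarrow> \<exists>i<k. P = tval (th P) i"
      by metis
    define \<theta>0 where "\<theta>0 e \<longleftrightarrow> (\<forall>\<theta>\<in>th ` (\<Sigma>0 - brk ` {..<k}). \<theta> e)" for e
    have \<theta>0: "definable L M {..<length (a @ b)} A \<theta>0" "\<theta>0 (nth (a @ b))"
    proof -
      show "definable L M {..<length (a @ b)} A \<theta>0"
        unfolding \<theta>0_def[abs_def] using fin th(1)
        by (intro definable_Ball univ_ne) (auto simp: \<Theta>_def)
      show "\<theta>0 (nth (a @ b))" using th(1) by (auto simp: \<theta>0_def \<Theta>_def)
    qed
    obtain S x where S: "finite S" "card S = k" and x: "x \<in> tuples M (length a)"
        and Sx: "\<And>i. i \<in> S \<Longrightarrow> \<theta>0 (nth (x @ bs i))"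
      using cons[OF \<theta>0] by blast
    \<comment> \<open>The increasing enumeration of \<open>S\<close>, so that moving block \<open>s i\<close> to block \<open>i\<close> preserves the order
      of positions.\<close>
    define s where "s i = sorted_list_of_set S ! i" for i
    have s: "s i \<in> S" if "i < k" for i
      using that S nth_mem[of i "sorted_list_of_set S"] by (simp add: s_def)
    have "s i < s i'" if "i < i'" "i' < k" for i i'
      using sorted_wrt_nth_less[OF strict_sorted_list_of_set[of S], of i i'] that S
      by (simp add: s_def)
    then have s_less: "s i < s i' \<longleftrightarrow> i < i'" "s i = s i' \<longleftrightarrow> i = i'" if "i < k" "i' < k" for i i'
      using that by (metis linorder_neqE_nat order_less_asym order_less_irrefl)+
    define W where "W = (UNIV :: (nat \<times> nat) set) <+>
      {(j :: nat, q :: nat \<times> nat, t). j < N \<and> t < l j \<and> fst q < k}"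
    define R where "R e \<longleftrightarrow> (\<forall>i\<in>{..<k}. \<theta>0 (\<lambda>s. e (Inl (f i s))) \<and>
        \<psi> (\<lambda>v. e (map_sum (\<lambda>t. (Suc i, t)) (\<lambda>(j, m, t). (j, (i, m), t)) v)))"
      for e :: "(nat \<times> nat) + (nat \<times> (nat \<times> nat) \<times> nat) \<Rightarrow> 'a"
    define Q where "Q e \<longleftrightarrow> (\<exists>e'. (\<forall>v. v \<notin> range Inl \<longrightarrow> e' v = e v) \<and>
        e' ` range Inl \<subseteq> univ M \<and> R e')" for e
    have "definable L M W A (\<lambda>e. \<theta>0 (\<lambda>s. e (Inl (f i s))))" for i
      using \<theta>0(1) by (rule definable_reindex) (auto simp: W_def)
    moreover have "definable L M W A
        (\<lambda>e. \<psi> (\<lambda>v. e (map_sum (\<lambda>t. (Suc i, t)) (\<lambda>(j, m, t). (j, (i, m), t)) v)))"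
      if "i < k" for i
      using \<psi> by (rule definable_reindex) (use that in \<open>auto simp: V_def W_def\<close>)
    ultimately have "definable L M W A R"
      unfolding R_def[abs_def] by (intro definable_Ball univ_ne definable_And) auto
    then have Q: "definable L M (W - range Inl) A Q"
      unfolding Q_def[abs_def] by (intro definable_project univ_ne)
    define jj tt qq where "jj = (\<lambda>v :: (nat \<times> nat) + (nat \<times> (nat \<times> nat) \<times> nat). fst (projr v))"
      and "tt = (\<lambda>v :: (nat \<times> nat) + (nat \<times> (nat \<times> nat) \<times> nat). snd (snd (projr v)))"
      and "qq = (\<lambda>v :: (nat \<times> nat) + (nat \<times> (nat \<times> nat) \<times> nat). fst (snd (projr v)))"
    have "Q (\<lambda>v. G (jj v) (s (fst (qq v)), snd (qq v)) ! tt v) = Q (\<lambda>v. G (jj v) (qq v) ! tt v)"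
    proof (rule same_EM_type_transfer[OF GG Q])
      show "same_order {v \<in> W - range Inl. jj v = i} (\<lambda>v. (s (fst (qq v)), snd (qq v))) qq" for i
        using s_less by (auto simp: same_order_def W_def qq_def less_prod_def le_less)
    qed (auto simp: W_def jj_def tt_def)
    moreover have "Q (\<lambda>v. G (jj v) (s (fst (qq v)), snd (qq v)) ! tt v)"
    proof -
      obtain y where y: "range y \<subseteq> univ M" "\<And>t. t < length a \<Longrightarrow> y t = x ! t"
        using tuple_padding[OF x] by blast
      have "\<exists>z. range z \<subseteq> univ M \<and> (\<forall>t<length b. z t = bs i ! t)" for i
        using tuple_padding[OF bs(1)] by metis
      then obtain z where z: "\<And>i. range (z i) \<subseteq> univ M" "\<And>i t. t < length b \<Longrightarrow> z i t = bs i ! t"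
        by metis
      define e' where "e' = case_sum (\<lambda>(r, t). case r of 0 \<Rightarrow> y t | Suc i \<Rightarrow> z (s i) t)
        (\<lambda>(j, q, t). G j (s (fst q), snd q) ! t)"
      have "\<theta>0 (\<lambda>r. e' (Inl (f i r)))" if "i < k" for i
      proof -
        have "\<theta>0 (\<lambda>r. e' (Inl (f i r))) = \<theta>0 (nth (x @ bs (s i)))"
          using x by (intro definable_cong[OF \<theta>0(1)])
            (auto simp: e'_def f_def nth_append y(2) z(2) tuples_def)
        then show ?thesis using Sx s[OF that] by simp
      qed
      moreover have "\<psi> (\<lambda>v. e' (map_sum (\<lambda>t. (Suc i, t)) (\<lambda>(j, m, t). (j, (i, m), t)) v))" for i
      proof -
        have "\<psi> (\<lambda>v. e' (map_sum (\<lambda>t. (Suc i, t)) (\<lambda>(j, m, t). (j, (i, m), t)) v)) =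
            \<psi> (case_sum (nth (bs (s i))) (\<lambda>(j, m, t). G j (s i, m) ! t))"
          by (intro definable_cong[OF \<psi>]) (auto simp: V_def e'_def z(2))
        then show ?thesis using bs(2) by simp
      qed
      ultimately have "R e'" by (simp add: R_def)
      moreover have "e' v = G (jj v) (s (fst (qq v)), snd (qq v)) ! tt v" if "v \<notin> range Inl" for v
        using that by (cases v) (auto simp: e'_def jj_def qq_def tt_def)
      moreover have "e' ` range Inl \<subseteq> univ M"
        using y(1) z(1) by (auto simp: e'_def image_subset_iff split: nat.splits)
      ultimately show ?thesis unfolding Q_def by blast
    qed
    ultimately have "Q (\<lambda>v. G (jj v) (qq v) ! tt v)" by (rule subst)
    then obtain e' where e': "\<And>v. v \<notin> range Inl \<Longrightarrow> e' v = G (jj v) (qq v) ! tt v"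
        "e' ` range Inl \<subseteq> univ M" "R e'"
      unfolding Q_def by blast
    define e where "e v = e' (Inl v)" for v
    have "e' (Inr (j, q, t)) = G j q ! t" for j q t
      using e'(1)[of "Inr (j, q, t)"] by (auto simp: jj_def qq_def tt_def)
    then have "e' (map_sum (\<lambda>t. (Suc i, t)) (\<lambda>(j, m, t). (j, (i, m), t)) v) =
        case_sum (\<lambda>t. e (Suc i, t)) (\<lambda>(j, m, t). G j (i, m) ! t) v" for i v
      by (cases v) (auto simp: e_def)
    then have "tval \<theta>0 i e \<and> brk i e" if "i < k" for i
      using e'(3) that by (simp add: R_def tval_def brk_def e_def[symmetric])
    moreover have "P e" if P: "P \<in> \<Sigma>0" "P \<notin> brk ` {..<k}" "\<And>i. i < k \<Longrightarrow> tval \<theta>0 i e" for P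
    proof -
      obtain i where "i < k" "P = tval (th P) i" using th(2)[of P] P(1,2) by blast
      moreover from this have "tval \<theta>0 i e" using P(3) by blast
      ultimately show ?thesis using P(1,2) unfolding tval_def \<theta>0_def by (metis DiffI image_eqI)
    qed
    moreover have "range e \<subseteq> univ M" using e'(2) by (auto simp: e_def)
    ultimately show "\<exists>e. range e \<subseteq> univ M \<and> (\<forall>P\<in>\<Sigma>0. P e)" by blast
  qed
  then obtain e where e: "range e \<subseteq> univ M" "\<And>P. P \<in> \<Sigma> \<Longrightarrow> P e" by blast
  define a' where "a' = map (\<lambda>t. e (0, t)) [0..<length a]"
  define b' where "b' i = map (\<lambda>t. e (Suc i, t)) [0..<length b]" for i
  show thesis
  proof
    show "a' \<in> tuples M (length a)" "\<And>i. b' i \<in> tuples M (length b)"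
      using e(1) by (auto simp: a'_def b'_def tuples_def)
    fix i assume i: "i < k"
    have eq: "a' @ b' i = map (\<lambda>s. e (f i s)) [0..<length (a @ b)]"
      by (intro nth_equalityI) (auto simp: a'_def b'_def f_def nth_append)
    have "\<theta> (\<lambda>s. e (f i s))"
      if "definable L M {..<length (a @ b)} A \<theta>" "\<theta> (nth (a @ b))" for \<theta>
    proof -
      have "tval \<theta> i \<in> \<Sigma>" using that i unfolding \<Sigma>_def \<Theta>_def by blast
      then have "tval \<theta> i e" by (rule e(2))
      then show ?thesis by (simp add: tval_def)
    qed
    then show "tp L M (a' @ b' i) A = tp L M (a @ b) A"
      unfolding eq by (rule tp_map_eqI)
    have "brk i e" using e(2)[of "brk i"] i by (simp add: \<Sigma>_def)
    moreover have "\<psi> (case_sum (nth (b' i)) (\<lambda>(j, m, t). G j (i, m) ! t)) = brk i e"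
      unfolding brk_def by (rule definable_cong[OF \<psi>]) (auto simp: V_def b'_def)
    ultimately show "\<psi> (case_sum (nth (b' i)) (\<lambda>(j, m, t). G j (i, m) ! t))" by simp
  qed
qed

lemma tp_append_left:
  assumes eq: "tp L M (u @ v) A = tp L M (u' @ v') A"
    and len: "length u = length u'" "length v = length v'"
  shows "tp L M u A = tp L M u' A"
proof (subst tp_eq_iff[OF len(1)], intro allI impI)
  fix P assume P: "definable L M {..<length u'} A P"
  then have "definable L M {..<length (u' @ v')} A P" by (rule definable_mono) auto
  then have "P (nth (u @ v)) = P (nth (u' @ v'))"
    using tp_eq_iff[of "u @ v" "u' @ v'", THEN iffD1, OF _ eq, rule_format] len by simp
  moreover have "P (nth (u @ v)) = P (nth u)" "P (nth (u' @ v')) = P (nth u')"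
    by (rule definable_cong[OF P], simp add: nth_append len)+
  ultimately show "P (nth u) = P (nth u')" by simp
qed

end


section \<open>Rank under non-forking extensions\<close>

theorem corollary3p7:
  fixes L :: "('f, 'r) language" and T :: "('f, 'r) fm set"
    and \<kappa> :: "'k rel" and M :: "('f, 'r, 'a) struct"
    and a b :: "'a list" and A :: "'a set"
  assumes "complete_theory L T"
    and "monster_model L T \<kappa> M"
    and "dp_rank_additive L \<kappa> M"
    and "dp_rank_finite L M"
    and "set a \<subseteq> univ M" and "set b \<subseteq> univ M"
    and "small \<kappa> M A"
    and "\<not> forks L M A (length a) (tp L M a (A \<union> set b))"
  shows "dpr L M a A = dpr L M a (A \<union> set b)"
proof (rule ccontr)
  assume neq: "dpr L M a A \<noteq> dpr L M a (A \<union> set b)"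
  interpret monster L T \<kappa> M by unfold_locales fact
  note add = \<open>dp_rank_additive L \<kappa> M\<close> and A = \<open>small \<kappa> M A\<close>
    and ab = \<open>set a \<subseteq> univ M\<close> \<open>set b \<subseteq> univ M\<close>
  have sum: "dpr L M (u @ v) A = dpr L M u (A \<union> set v) + dpr L M v A"
    if "set u \<subseteq> univ M" "set v \<subseteq> univ M" for u v
    using add A that unfolding dp_rank_additive_def by blast
  have finite: "\<exists>n. dpr L M u B = enat n" if "set u \<subseteq> univ M" "small \<kappa> M B" for u B
    using dpr_finite[OF add \<open>dp_rank_finite L M\<close> that] by auto
  obtain r r' d N where r: "dpr L M a A = enat r" and r': "dpr L M a (A \<union> set b) = enat r'"
      and d: "dpr L M b (A \<union> set a) = enat d" and N: "dpr L M b A = enat N"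
    using finite ab A small_Un_set by metis
  have "r' < r"
    using dpr_mono[of A "A \<union> set b" M L a] neq small_subset_univ[OF A] ab(2) r r' by auto
  moreover have "r' + N = d + r"
    using sum[OF ab] sum[OF ab(2,1)] dpr_append_commute[of L M a b A] r r' d N by simp
  ultimately have dN: "d < N" by simp
  obtain G :: "nat \<Rightarrow> nat \<times> nat \<Rightarrow> 'a list" and l \<psi> bs where
    G: "\<And>j q. j < N \<Longrightarrow> G j q \<in> tuples M (l j)" "same_EM_type L M A {..<N} l G G"
    and \<psi>: "definable L M ({..<length b} <+> {(j, m, t). j < N \<and> t < l j}) A \<psi>"
    and breaks: "\<And>c i j. length c = length b \<Longrightarrow> \<psi> (case_sum (nth c) (\<lambda>(j, m, t). G j (i, m) ! t)) \<Longrightarrow>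
      j < N \<Longrightarrow> \<not> indiscernible L M (A \<union> set c) (\<lambda>m. G j (i, m))"
    and bs: "\<And>i. bs i \<in> tuples M (length b)" "\<And>i. tp L M (bs i) A = tp L M b A"
      "\<And>i. \<psi> (case_sum (nth (bs i)) (\<lambda>(j, m, t). G j (i, m) ! t))"
    by (rule independent_copies[OF A dpr_attained[OF ab(2) N]]) (rule that)
  \<comment> \<open>The bounds \<open>k * N \<le> k * d + r\<close> and \<open>d < N\<close> are incompatible as soon as \<open>k > r\<close>.\<close>
  define k where "k = Suc r"
  obtain a' b' where a': "a' \<in> tuples M (length a)" and b': "\<And>i. i < k \<Longrightarrow> b' i \<in> tuples M (length b)"
    and ab': "\<And>i. i < k \<Longrightarrow> tp L M (a' @ b' i) A = tp L M (a @ b) A"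
    and \<psi>b': "\<And>i. i < k \<Longrightarrow> \<psi> (case_sum (nth (b' i)) (\<lambda>(j, m, t). G j (i, m) ! t))"
  proof (rule simultaneous_realization[OF A G \<psi> bs(1,3)])
    fix \<theta> assume \<theta>: "definable L M {..<length (a @ b)} A \<theta>" "\<theta> (nth (a @ b))"
    show "\<exists>S x. finite S \<and> card S = k \<and> x \<in> tuples M (length a) \<and> (\<forall>i\<in>S. \<theta> (nth (x @ bs i)))"
      by (rule non_forking_consistent[where bs = bs, OF assms(8) small_subset_univ[OF A] ab(2) bs(1,2) \<theta>])
  qed (assumption | rule that)+
  have len: "length a' = length a" "set a' \<subseteq> univ M" "length (b' i) = length b" "set (b' i) \<subseteq> univ M"
    if "i < k" for i
    using a' b'[OF that] by (auto simp: tuples_def)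
  have k: "0 < k" by (simp add: k_def)
  have ra': "dpr L M a' A = enat r"
    using tp_append_left[OF ab'[OF k]] len[OF k] r dpr_cong by metis
  have db': "dpr L M (b' i) (A \<union> set a') = enat d" if i: "i < k" for i
  proof -
    have "dpr L M (b' i @ a') A = dpr L M (b @ a) A"
      using dpr_cong[OF ab'[OF i]] len[OF i] by (simp add: dpr_append_commute)
    then have "dpr L M (b' i) (A \<union> set a') + enat r = enat d + enat r"
      using sum[of "b' i" a'] sum[OF ab(2,1)] len[OF i] ra' r d by simp
    then show ?thesis by (cases "dpr L M (b' i) (A \<union> set a')") auto
  qed
  define c where "c = concat (map b' [0..<k])"
  have c: "set c \<subseteq> univ M" using len(4) by (fastforce simp: c_def)
  have "enat (k * N) \<le> dpr L M c A"
    unfolding c_def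
    by (rule dpr_concat_ge[OF G]) (use len breaks \<psi>b' in auto)
  also have "\<dots> \<le> dpr L M (a' @ c) A"
    using sum[OF len(2)[OF k] c] by simp
  also have "\<dots> = dpr L M c (A \<union> set a') + dpr L M a' A"
    using sum[OF c len(2)[OF k]] by (simp add: dpr_append_commute)
  also have "\<dots> \<le> enat (k * d) + enat r"
  proof (rule add_mono)
    have "dpr L M c (A \<union> set a') \<le> enat (length (map b' [0..<k]) * d)"
      unfolding c_def
    proof (rule dpr_concat_le[OF add small_Un_set[OF A len(2)[OF k]]])
      fix u assume "u \<in> set (map b' [0..<k])"
      then obtain i where "i < k" "u = b' i" by auto
      then show "set u \<subseteq> univ M" "dpr L M u (A \<union> set a') \<le> enat d"
        using len(4) db' by auto
    qed
    then show "dpr L M c (A \<union> set a') \<le> enat (k * d)" by simp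
    show "dpr L M a' A \<le> enat r" by (simp add: ra')
  qed
  finally have "k * N \<le> k * d + r" by simp
  moreover have "k * Suc d \<le> k * N" using dN by (intro mult_le_mono2) simp
  ultimately show False by (simp add: k_def)
qed

end
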